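(* Let $m,n\ge 1$, let $a_0,a_1,a_2,a_3\in R=\mathbb{C}[s,u,t,v]$ be bihomogeneous polynomials of bidegree $(m,n)$, and let $I=\langle a_0,a_1,a_2,a_3\rangle$. Suppose that: (B1) $a_0,a_1,a_2,a_3$ are linearly independent over $\mathbb{C}$; (B2) the base point scheme $\mathbb{V}(I)\subset\mathbb{P}^1\times\mathbb{P}^1$ consists of a finite number of base points with total multiplicity $k\le mn$; (B3) each base point $\mathbf{p}\in\mathbb{V}(I)$ is a local complete intersection; (B4) $\dim_{\mathbb{C}}(R/I)_{2m-1,2n-1}=\deg(\mathbb{V}(I))$. Then $\dim_{\mathbb{C}}\mathrm{Syz}(a_0,a_1,a_2,a_3)_{m-1,n-1}=k$.
   Context: $R=\mathbb{C}[s,u,t,v]$ is bigraded with $s,u$ of bidegree $(1,0)$ and $t,v$ of bidegree $(0,1)$; a subscript $(k,l)$ denotes the bihomogeneous part of bidegree $(k,l)$. $\mathbb{V}(I)$ is the subscheme of $X=\mathbb{P}^1\times\mathbb{P}^1$ defined by $I$; if it is finite, $\deg(\mathbb{V}(I))=\dim_{\mathbb{C}}H^0(\mathbb{V}(I),\mathcal{O})$. Base points are the points of $\mathbb{V}(I)$. With $\mathcal{I}$ the ideal sheaf of $I$, the multiplicity of a base point $\mathbf{p}$ is the (Hilbert–Samuel) multiplicity $e(I,\mathbf{p})$ of the ideal $\mathcal{I}_{\mathbf{p}}\subset\mathcal{O}_{X,\mathbf{p}}$, and the total multiplicity is $\sum_{\mathbf{p}\in\mathbb{V}(I)}e(I,\mathbf{p})$.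 A base point $\mathbf{p}$ is a local complete intersection if $\mathcal{I}_{\mathbf{p}}$ is generated by two elements. $\mathrm{Syz}(a_0,a_1,a_2,a_3)_{m-1,n-1}=\{(A_0,A_1,A_2,A_3)\in R_{m-1,n-1}^4:\sum_iA_ia_i=0\}$. *)

theory Defs
  imports
    "HOL-Algebra.Ideal_Product"
    "HOL-Computational_Algebra.Computational_Algebra"
    "HOL-Library.Extended_Nat"
    "HOL-Library.Function_Algebras"
    "HOL-Library.Product_Plus"
begin

section \<open>The bigraded ring C[s,u,t,v]\<close>

text \<open>The outermost variable is s, followed by u, t, and (innermost) v.\<close>

type_synonym bipoly = "complex poly poly poly poly"

definition bicoeff :: "bipoly \<Rightarrow> nat \<Rightarrow> nat \<Rightarrow> nat \<Rightarrow> nat \<Rightarrow> complex" where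
  "bicoeff f i j k l = coeff (coeff (coeff (coeff f i) j) k) l"

definition bihom :: "nat \<Rightarrow> nat \<Rightarrow> bipoly set" where
  "bihom d e = {f. \<forall>i j k l. bicoeff f i j k l \<noteq> 0 \<longrightarrow> i + j = d \<and> k + l = e}"

definition bieval :: "bipoly \<Rightarrow> complex \<times> complex \<Rightarrow> complex \<times> complex \<Rightarrow> complex" where
  "bieval f x y =
     poly (poly (poly (poly f [:[:[:fst x:]:]:]) [:[:snd x:]:]) [:fst y:]) (snd y)"

definition bconst :: "complex \<Rightarrow> bipoly" where
  "bconst c = [:[:[:[:c:]:]:]:]"

definition bscale :: "complex \<Rightarrow> bipoly \<Rightarrow> bipoly" where
  "bscale c f = bconst c * f"

definition gen_ideal :: "bipoly set \<Rightarrow> bipoly set" where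
  "gen_ideal A = module.span (*) A"


section \<open>Dimensions and lengths of quotients\<close>

text \<open>
  The dimension of V/W for complex subspaces W of V: the supremum of the sizes of finite
  subsets of V that are linearly independent modulo W.
\<close>

definition quot_dim ::
    "(complex \<Rightarrow> 'b \<Rightarrow> 'b) \<Rightarrow> 'b::comm_monoid_add set \<Rightarrow> 'b set \<Rightarrow> enat" where
  "quot_dim scale V W =
     Sup {enat (card B) | B. finite B \<and> B \<subseteq> V \<and>
       (\<forall>c. (\<Sum>b\<in>B. scale (c b) b) \<in> W \<longrightarrow> (\<forall>b\<in>B. c b = 0))}"

text \<open>
  The length of the A-module A/J for an ideal J of a commutative ring A; the submodules
  of A/J correspond to the ideals of A that contain J.
\<close>

definition quot_length :: "('a, 'b) ring_scheme \<Rightarrow> 'a set \<Rightarrow> enat" where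
  "quot_length A J =
     Sup {enat r | r. \<exists>C. (\<forall>i\<le>r. ideal (C i) A \<and> J \<subseteq> C i) \<and> (\<forall>i<r. C i \<subset> C (Suc i))}"


section \<open>The surface X = P^1 x P^1 and its local rings\<close>

text \<open>
  A point of the projective line is the set of its pairs of homogeneous coordinates. Only
  closed points occur: a subscheme of X is finite if and only if it has finitely many
  closed points, and then it has no other points.
\<close>

definition proj_rel :: "((complex \<times> complex) \<times> (complex \<times> complex)) set" where
  "proj_rel = {(x, y). x \<noteq> (0, 0) \<and> y \<noteq> (0, 0) \<and> (\<exists>c. y = (c * fst x, c * snd x))}"

definition P1 :: "(complex \<times> complex) set set" where
  "P1 = (UNIV - {(0, 0)}) // proj_rel"

type_synonym point = "(complex \<times> complex) set \<times> (complex \<times> complex) set"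

text \<open>
  For a bihomogeneous f the value is zero for all choices of homogeneous coordinates
  as soon as it is zero for one choice.
\<close>

definition vanishes_at :: "bipoly \<Rightarrow> point \<Rightarrow> bool" where
  "vanishes_at f p \<longleftrightarrow> (\<forall>x\<in>fst p. \<forall>y\<in>snd p. bieval f x y = 0)"

text \<open>
  The stalk at p of the ideal sheaf of a bihomogeneous ideal I, inside the field of
  fractions of C[s,u,t,v]: the bidegree (0,0) part of the localization of I at p.
\<close>

definition stalk :: "bipoly set \<Rightarrow> point \<Rightarrow> bipoly fract set" where
  "stalk I p = {Fract f g | f g. f \<in> I \<and> \<not> vanishes_at g p \<and>
     (\<exists>d e. f \<in> bihom d e \<and> g \<in> bihom d e)}"

definition local_ring :: "point \<Rightarrow> bipoly fract ring" where
  "local_ring p = \<lparr>carrier = stalk UNIV p, monoid.mult = (*), one = 1, zero = 0, add = (+)\<rparr>"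


section \<open>The base point scheme\<close>

definition base_points :: "bipoly set \<Rightarrow> point set" where
  "base_points I = {p \<in> P1 \<times> P1. \<forall>f\<in>I. vanishes_at f p}"

definition lci_at :: "bipoly set \<Rightarrow> point \<Rightarrow> bool" where
  "lci_at I p \<longleftrightarrow>
     (\<exists>f \<in> carrier (local_ring p). \<exists>g \<in> carrier (local_ring p).
        stalk I p = Idl\<^bsub>local_ring p\<^esub> {f, g})"

text \<open>
  The Hilbert-Samuel multiplicity in the two-dimensional local ring at p. The lengths are
  finite when p is an isolated base point.
\<close>

definition hs_mult :: "bipoly set \<Rightarrow> point \<Rightarrow> real" where
  "hs_mult I p =
     lim (\<lambda>j. fact 2 * real (the_enat (quot_length (local_ring p)
                (stalk I p [^]\<^bsub>ideals_set (local_ring p)\<^esub> j))) / real j ^ 2)"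

text \<open>
  The global sections of the structure sheaf of V(I) are the functions that assign to each
  point p of V(I) an element of the local ring at p modulo the stalk of the ideal sheaf
  and that are given, near each point of V(I), by one fraction f/g of bihomogeneous
  polynomials of the same bidegree. As f and g may be multiplied by a common factor, it
  suffices to consider the neighbourhoods where g does not vanish. Such functions are
  represented by functions into the field of fractions; lift_sections collects the
  representatives of all sections and lift_zero those of the zero section. Values outside
  V(I) are irrelevant, as both sets leave them arbitrary.
\<close>

definition lift_sections :: "bipoly set \<Rightarrow> (point \<Rightarrow> bipoly fract) set" where
  "lift_sections I =
     {\<sigma>. \<forall>p \<in> base_points I.
        \<sigma> p \<in> carrier (local_ring p) \<and>
        (\<exists>d e. \<exists>f \<in> bihom d e. \<exists>g \<in> bihom d e. \<not> vanishes_at g p \<and>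
           (\<forall>q \<in> base_points I. \<not> vanishes_at g q \<longrightarrow> \<sigma> q - Fract f g \<in> stalk I q))}"

definition lift_zero :: "bipoly set \<Rightarrow> (point \<Rightarrow> bipoly fract) set" where
  "lift_zero I = {\<sigma>. \<forall>p \<in> base_points I. \<sigma> p \<in> stalk I p}"

definition scheme_degree :: "bipoly set \<Rightarrow> enat" where
  "scheme_degree I =
     quot_dim (\<lambda>c \<sigma> p. Fract (bconst c) 1 * \<sigma> p) (lift_sections I) (lift_zero I)"


section \<open>Syzygies\<close>

definition bscale4 ::
    "complex \<Rightarrow> bipoly \<times> bipoly \<times> bipoly \<times> bipoly \<Rightarrow> bipoly \<times> bipoly \<times> bipoly \<times> bipoly" where
  "bscale4 c = (\<lambda>(A0, A1, A2, A3). (bscale c A0, bscale c A1, bscale c A2, bscale c A3))"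

definition Syz ::
    "bipoly \<Rightarrow> bipoly \<Rightarrow> bipoly \<Rightarrow> bipoly \<Rightarrow> nat \<Rightarrow> nat \<Rightarrow>
     (bipoly \<times> bipoly \<times> bipoly \<times> bipoly) set" where
  "Syz a0 a1 a2 a3 d e =
     {(A0, A1, A2, A3). A0 \<in> bihom d e \<and> A1 \<in> bihom d e \<and> A2 \<in> bihom d e \<and> A3 \<in> bihom d e \<and>
        A0 * a0 + A1 * a1 + A2 * a2 + A3 * a3 = 0}"

end

theory Submission
  imports Defs "HOL-Computational_Algebra.Field_as_Ring"
begin

text \<open>
  The map \<open>(A\<^sub>i) \<mapsto> \<Sum>A\<^sub>i a\<^sub>i\<close> from \<open>R\<^sub>m\<^sub>-\<^sub>1\<^sub>,\<^sub>n\<^sub>-\<^sub>1\<^sup>4\<close> onto the part of \<open>I\<close> of bidegree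
  \<open>(2m - 1, 2n - 1)\<close> has kernel \<open>Syz\<close>, and its source has the same dimension \<open>4mn\<close> as the
  whole part of \<open>R\<close> of that bidegree. So \<open>dim Syz\<close> is the degree of the base point scheme
  by (B4), in particular this degree is finite, and by the separation of points it is the sum of
  the colengths of the stalks. At a base point the ideal is generated by two elements and has
  finite colength; the local ring is a localization of a factorial ring, hence the generators
  form a regular sequence. Then \<open>I\<^sup>j / I\<^sup>j\<^sup>+\<^sup>1\<close> has length \<open>j + 1\<close> times the colength of \<open>I\<close>, so
  that the multiplicity is the colength.
\<close>

section \<open>Dimensions of quotients\<close>

text \<open>The multiplicity is defined through lengths, the degree and the syzygies through complex
  dimensions. The two counts agree because the residue field at a closed point is C. All dimensions
  live in \<open>enat\<close>, where cancelling requires finiteness, and this has a single source: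
  the part of R of bidegree (2m - 1, 2n - 1) has dimension (2m)(2n) = 4mn, so its quotient is
  finite-dimensional, and by (B4) every colength is finite. For regularity the gcd of the numerators
  of the two generators is taken in R. Neither this gcd nor the cofactors are known to be
  bihomogeneous, so suitable bihomogeneous components take their place. If d is the colength of I,
  the quotients of successive powers have lengths d, 2d, 3d and so on, because each length exceeds
  the previous one by d. The j-th power then has colength d j (j + 1) / 2, and the factor 2 in the
  Hilbert-Samuel multiplicity leaves exactly d.\<close>

locale complex_vector_space = vector_space scale
  for scale :: "complex \<Rightarrow> 'b::ab_group_add \<Rightarrow> 'b" (infixr \<open>*s\<close> 75)
begin

definition indep_mod :: "'b set \<Rightarrow> 'b set \<Rightarrow> bool" where
  "indep_mod W B \<longleftrightarrow> finite B \<and> (\<forall>c. (\<Sum>b\<in>B. c b *s b) \<in> W \<longrightarrow> (\<forall>b\<in>B. c b = 0))"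

text \<open>A relation modulo \<open>W\<close> in which \<open>v\<close> has a nonzero coefficient
  can be divided by it and then expresses \<open>v\<close> through \<open>B\<close> modulo
  \<open>W\<close>. Hence an independent set of maximal size spans.\<close>

lemma indep_mod_extend:
  assumes W: "subspace W" and B: "indep_mod W B" and v: "\<nexists>c. v - (\<Sum>b\<in>B. c b *s b) \<in> W"
  shows "v \<notin> B" "indep_mod W (insert v B)"
proof -
  have fin: "finite B" using B by (simp add: indep_mod_def)
  show vB: "v \<notin> B"
  proof
    assume "v \<in> B"
    then have "(\<Sum>b\<in>B. (if b = v then 1 else 0) *s b) = v"
      using fin by (simp add: if_distrib[of "\<lambda>x. x *s _"] cong: if_cong)
    then show False using v subspace_0[OF W] by (metis diff_self)
  qed
  have "\<forall>b\<in>insert v B. c b = 0" if c: "(\<Sum>b\<in>insert v B. c b *s b) \<in> W" for c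
  proof (cases "c v = 0")
    case True
    then show ?thesis using c B vB fin by (simp add: indep_mod_def)
  next
    case False
    have "(1 / c v) *s (c v *s v + (\<Sum>b\<in>B. c b *s b)) \<in> W"
      using c vB fin by (intro subspace_scale[OF W]) simp
    then have "v + (\<Sum>b\<in>B. (c b / c v) *s b) \<in> W"
      using False by (simp add: scale_right_distrib scale_sum_right)
    then have "v - (\<Sum>b\<in>B. (- (c b / c v)) *s b) \<in> W"
      by (simp add: sum_negf)
    then show ?thesis using v not_ex[of "\<lambda>c. v - (\<Sum>b\<in>B. c b *s b) \<in> W"] by fast
  qed
  then show "indep_mod W (insert v B)" using fin by (simp add: indep_mod_def)
qed

text \<open>Replacing each element by its component in the span of \<open>E\<close> reduces this to the
  exchange lemma.\<close>

lemma indep_mod_card_le: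
  assumes W: "subspace W" and D: "indep_mod W D" and E: "finite E"
    and DE: "\<And>v. v \<in> D \<Longrightarrow> \<exists>c. v - (\<Sum>b\<in>E. c b *s b) \<in> W"
  shows "card D \<le> card E"
proof -
  have fin: "finite D" using D by (simp add: indep_mod_def)
  have "\<exists>x. x \<in> span E \<and> v - x \<in> W" if "v \<in> D" for v
  proof -
    obtain c where "v - (\<Sum>b\<in>E. c b *s b) \<in> W" using DE[OF \<open>v \<in> D\<close>] by blast
    moreover have "(\<Sum>b\<in>E. c b *s b) \<in> span E" by (intro span_sum span_scale span_base)
    ultimately show ?thesis by blast
  qed
  then have "\<forall>v\<in>D. \<exists>x. x \<in> span E \<and> v - x \<in> W" by blast
  from bchoice[OF this] obtain e where e: "\<And>v. v \<in> D \<Longrightarrow> e v \<in> span E \<and> v - e v \<in> W"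
    by blast
  have z: "\<forall>v\<in>D. c v = 0" if c: "(\<Sum>v\<in>D. c v *s e v) = 0" for c
  proof -
    have "(\<Sum>v\<in>D. c v *s v) = (\<Sum>v\<in>D. c v *s (v - e v))"
      using c by (simp add: scale_right_diff_distrib sum_subtractf)
    also have "\<dots> \<in> W" using e by (intro subspace_sum[OF W] subspace_scale[OF W]) auto
    finally show ?thesis using D by (simp add: indep_mod_def)
  qed
  have inj: "inj_on e D"
  proof
    fix x y assume xy: "x \<in> D" "y \<in> D" "e x = e y"
    show "x = y"
    proof (rule ccontr)
      assume "x \<noteq> y"
      let ?c = "\<lambda>v. if v = x then 1 else if v = y then - 1 else (0::complex)"
      have "(\<Sum>v\<in>D. ?c v *s e v) = (\<Sum>v\<in>{x, y}. ?c v *s e v)"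
        using xy fin by (intro sum.mono_neutral_right) auto
      also have "\<dots> = 0" using xy \<open>x \<noteq> y\<close> by simp
      finally have "?c x = 0" using z[of ?c] xy by blast
      then show False by simp
    qed
  qed
  have "independent (e ` D)"
  proof (rule independent_if_scalars_zero)
    fix f x assume "(\<Sum>x\<in>e ` D. f x *s x) = 0" "x \<in> e ` D"
    then show "f x = 0" using z[of "f \<circ> e"] inj by (auto simp: sum.reindex)
  qed (use fin in simp)
  then have "card (e ` D) \<le> card E"
    using independent_span_bound[OF E, of "e ` D"] e by auto
  then show ?thesis using inj by (simp add: card_image)
qed

lemma quot_dim_indep_mod:
  "quot_dim scale V W = Sup {enat (card B) | B. indep_mod W B \<and> B \<subseteq> V}"
  unfolding quot_dim_def indep_mod_def by (rule arg_cong[where f = Sup]) auto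

lemma quot_dim_ge: "indep_mod W B \<Longrightarrow> B \<subseteq> V \<Longrightarrow> enat (card B) \<le> quot_dim scale V W"
  unfolding quot_dim_indep_mod by (intro Sup_upper) auto

lemma quot_dim_leI:
  "(\<And>B. indep_mod W B \<Longrightarrow> B \<subseteq> V \<Longrightarrow> enat (card B) \<le> x) \<Longrightarrow> quot_dim scale V W \<le> x"
  unfolding quot_dim_indep_mod by (intro Sup_least) auto

text \<open>Meant for families obtained as images or by choice. A repetition would give the relation
  with coefficients 1 and -1, so the members are distinct.\<close>

lemma quot_dim_ge_family:
  assumes W: "subspace W" and S: "finite S" and v: "\<And>i. i \<in> S \<Longrightarrow> v i \<in> V"
    and z: "\<And>c. (\<Sum>i\<in>S. scale (c i) (v i)) \<in> W \<Longrightarrow> \<forall>i\<in>S. c i = 0"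
  shows "enat (card S) \<le> quot_dim scale V W"
proof -
  have inj: "inj_on v S"
  proof
    fix x y assume xy: "x \<in> S" "y \<in> S" "v x = v y"
    show "x = y"
    proof (rule ccontr)
      assume "x \<noteq> y"
      let ?c = "\<lambda>i. if i = x then 1 else if i = y then - 1 else (0::complex)"
      have "(\<Sum>i\<in>S. scale (?c i) (v i)) = (\<Sum>i\<in>{x, y}. scale (?c i) (v i))"
        using xy S by (intro sum.mono_neutral_right) auto
      also have "\<dots> = 0" using xy \<open>x \<noteq> y\<close> by simp
      finally have "?c x = 0" using z[of ?c] xy subspace_0[OF W] by auto
      then show False by simp
    qed
  qed
  have "indep_mod W (v ` S)" unfolding indep_mod_def
  proof (intro conjI allI impI)
    fix c assume "(\<Sum>b\<in>v ` S. scale (c b) b) \<in> W"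
    then show "\<forall>b\<in>v ` S. c b = 0" using z[of "c \<circ> v"] inj by (auto simp: sum.reindex)
  qed (use S in simp)
  from quot_dim_ge[OF this] v inj show ?thesis by (auto simp: card_image)
qed

text \<open>A finite supremum of sizes is attained, and a set attaining it spans \<open>V\<close>
  modulo \<open>W\<close>, since otherwise \<open>indep_mod_extend\<close> would give a larger
  one.\<close>

lemma quot_dim_basis:
  assumes W: "subspace W" and d: "quot_dim scale V W = enat d"
  obtains B where "indep_mod W B" "B \<subseteq> V" "card B = d"
    "\<And>v. v \<in> V \<Longrightarrow> \<exists>c. v - (\<Sum>b\<in>B. scale (c b) b) \<in> W"
proof -
  let ?S = "{enat (card B) | B. indep_mod W B \<and> B \<subseteq> V}"
  have "indep_mod W {}" by (simp add: indep_mod_def)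
  then have ne: "?S \<noteq> {}" by force
  have "?S \<subseteq> enat ` {..d}"
  proof
    fix x assume "x \<in> ?S"
    then obtain B where B: "x = enat (card B)" "indep_mod W B" "B \<subseteq> V" by blast
    from quot_dim_ge[OF B(2,3)] d B(1) show "x \<in> enat ` {..d}" by auto
  qed
  then have "finite ?S" by (rule finite_subset) simp
  then have "Sup ?S = Max ?S" using ne unfolding Sup_enat_def by (simp only: if_False if_True)
  moreover have "Max ?S \<in> ?S" by (rule Max_in[OF \<open>finite ?S\<close> ne])
  ultimately have "enat d \<in> ?S" using d unfolding quot_dim_indep_mod by simp
  then obtain B where B: "indep_mod W B" "B \<subseteq> V" "card B = d" by auto
  have "\<exists>c. v - (\<Sum>b\<in>B. scale (c b) b) \<in> W" if v: "v \<in> V" for v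
  proof (rule ccontr)
    assume n: "\<nexists>c. v - (\<Sum>b\<in>B. scale (c b) b) \<in> W"
    note e = indep_mod_extend[OF W B(1) n]
    have "finite B" using B(1) by (simp add: indep_mod_def)
    then show False using quot_dim_ge[OF e(2), of V] e(1) v B d by simp
  qed
  then show ?thesis using that B by blast
qed

lemma quot_dim_le_card:
  assumes W: "subspace W" and E: "finite E"
    and VE: "\<And>v. v \<in> V \<Longrightarrow> \<exists>c. v - (\<Sum>b\<in>E. scale (c b) b) \<in> W"
  shows "quot_dim scale V W \<le> enat (card E)"
  using indep_mod_card_le[OF W _ E] VE by (intro quot_dim_leI) auto

lemma quot_dim_self:
  assumes "subspace W" shows "quot_dim scale W W = 0"
  using quot_dim_le_card[OF assms, of "{}" W] by (simp add: zero_enat_def[symmetric])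

lemma quot_dim_mono:
  assumes "W' \<subseteq> W" "V \<subseteq> V'"
  shows "quot_dim scale V W \<le> quot_dim scale V' W'"
  using assms by (intro quot_dim_leI quot_dim_ge) (auto simp: indep_mod_def)

text \<open>Modulo \<open>U\<close> the part of a relation over \<open>B\<close> disappears, so the
  coefficients over \<open>C\<close> vanish first; what remains is a relation over \<open>B\<close>
  modulo \<open>W\<close>.\<close>

lemma indep_mod_Un:
  assumes U: "subspace U" and W: "subspace W" "W \<subseteq> U"
    and B: "indep_mod W B" "B \<subseteq> U" and C: "indep_mod U C"
  shows "B \<inter> C = {}" "indep_mod W (B \<union> C)"
proof -
  have fin: "finite B" "finite C" using B C by (auto simp: indep_mod_def)
  show disj: "B \<inter> C = {}"
  proof (rule ccontr)
    assume "B \<inter> C \<noteq> {}"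
    then obtain b where b: "b \<in> B" "b \<in> C" by blast
    let ?c = "\<lambda>v. if v = b then 1 else (0::complex)"
    have "(\<Sum>v\<in>C. scale (?c v) v) = b"
      using fin b by (simp add: if_distrib[of "\<lambda>x. scale x _"] cong: if_cong)
    then have "(\<Sum>v\<in>C. scale (?c v) v) \<in> U" using b B(2) by auto
    then have "?c b = 0" using C[unfolded indep_mod_def, THEN conjunct2, rule_format, of ?c] b(2) by blast
    then show False by simp
  qed
  show "indep_mod W (B \<union> C)" unfolding indep_mod_def
  proof (intro conjI allI impI)
    show "finite (B \<union> C)" using fin by simp
    fix c assume "(\<Sum>b\<in>B \<union> C. scale (c b) b) \<in> W"
    then have c: "(\<Sum>b\<in>B. scale (c b) b) + (\<Sum>b\<in>C. scale (c b) b) \<in> W"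
      using disj fin by (simp add: sum.union_disjoint)
    moreover have bU: "(\<Sum>b\<in>B. scale (c b) b) \<in> U"
      using B(2) by (intro subspace_sum[OF U] subspace_scale[OF U]) auto
    ultimately have "(\<Sum>b\<in>C. scale (c b) b) \<in> U"
      using W(2) subspace_diff[OF U] by (metis add_diff_cancel_left' subsetD)
    then have cC: "\<forall>b\<in>C. c b = 0" using C by (simp add: indep_mod_def)
    then have "(\<Sum>b\<in>B. scale (c b) b) \<in> W" using c by simp
    then show "\<forall>b\<in>B \<union> C. c b = 0" using B(1) cC by (auto simp: indep_mod_def)
  qed
qed

lemma quot_dim_add:
  assumes V: "subspace V" and U: "subspace U" and W: "subspace W" and WU: "W \<subseteq> U" and UV: "U \<subseteq> V"
  shows "quot_dim scale V W = quot_dim scale V U + quot_dim scale U W"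
proof (rule antisym)
  show "quot_dim scale V W \<le> quot_dim scale V U + quot_dim scale U W"
  proof (cases "quot_dim scale V U = \<infinity> \<or> quot_dim scale U W = \<infinity>")
    case False
    then obtain d e where de: "quot_dim scale V U = enat d" "quot_dim scale U W = enat e" by auto
    obtain C where C: "indep_mod U C" "C \<subseteq> V" "card C = d"
      "\<And>v. v \<in> V \<Longrightarrow> \<exists>c. v - (\<Sum>b\<in>C. scale (c b) b) \<in> U"
      using quot_dim_basis[OF U de(1)] by blast
    obtain B where B: "indep_mod W B" "B \<subseteq> U" "card B = e"
      "\<And>v. v \<in> U \<Longrightarrow> \<exists>c. v - (\<Sum>b\<in>B. scale (c b) b) \<in> W"
      using quot_dim_basis[OF W de(2)] by blast
    have disj: "B \<inter> C = {}" by (rule indep_mod_Un[OF U W WU B(1,2) C(1)])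
    have fin: "finite B" "finite C" using B C by (auto simp: indep_mod_def)
    have "\<exists>c. v - (\<Sum>b\<in>B \<union> C. scale (c b) b) \<in> W" if vV: "v \<in> V" for v
    proof -
      obtain c where "v - (\<Sum>b\<in>C. scale (c b) b) \<in> U" using C(4)[OF vV] by blast
      then obtain c' where c': "v - (\<Sum>b\<in>C. scale (c b) b) - (\<Sum>b\<in>B. scale (c' b) b) \<in> W"
        using B(4) by blast
      let ?c = "\<lambda>b. if b \<in> B then c' b else c b"
      have "(\<Sum>b\<in>B \<union> C. scale (?c b) b) = (\<Sum>b\<in>B. scale (?c b) b) + (\<Sum>b\<in>C. scale (?c b) b)"
        using disj fin by (simp add: sum.union_disjoint)
      also have "(\<Sum>b\<in>B. scale (?c b) b) = (\<Sum>b\<in>B. scale (c' b) b)" by (rule sum.cong) auto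
      also have "(\<Sum>b\<in>C. scale (?c b) b) = (\<Sum>b\<in>C. scale (c b) b)"
        using disj by (intro sum.cong) auto
      finally show ?thesis using c' by (intro exI[of _ ?c]) (simp add: algebra_simps)
    qed
    then have "quot_dim scale V W \<le> enat (card (B \<union> C))"
      using fin by (intro quot_dim_le_card[OF W]) auto
    then show ?thesis using de disj fin B(3) C(3) by (simp add: card_Un_disjoint add.commute)
  qed auto
next
  have *: "enat (card C + card B) \<le> quot_dim scale V W"
    if "indep_mod W B" "B \<subseteq> U" "indep_mod U C" "C \<subseteq> V" for B C
  proof -
    note BC = indep_mod_Un[OF U W WU that(1,2,3)]
    have fin: "finite B" "finite C" using that by (auto simp: indep_mod_def)
    show ?thesis using quot_dim_ge[OF BC(2), of V] that UV BC(1) fin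
      by (simp add: card_Un_disjoint add.commute)
  qed
  show "quot_dim scale V U + quot_dim scale U W \<le> quot_dim scale V W"
  proof (cases "quot_dim scale V W")
    case (enat d)
    \<comment> \<open>Monotonicity makes both summands finite, so that both quotients have bases,
      whose union is independent by \<open>*\<close>.\<close>
    have "quot_dim scale V U \<le> enat d" "quot_dim scale U W \<le> enat d"
      using quot_dim_mono[OF WU, of V V] quot_dim_mono[OF _ UV, of W W] enat by auto
    then obtain e f where ef: "quot_dim scale V U = enat e" "quot_dim scale U W = enat f"
      by (auto simp: enat_ile dest!: enat_ile)
    obtain C where C: "indep_mod U C" "C \<subseteq> V" "card C = e"
      using quot_dim_basis[OF U ef(1)] by blast
    obtain B where B: "indep_mod W B" "B \<subseteq> U" "card B = f"
      using quot_dim_basis[OF W ef(2)] by blast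
    show ?thesis using *[OF B(1,2) C(1,2)] ef B C by simp
  qed auto
qed

lemma quot_dim_chain:
  assumes "\<And>i. i \<le> r \<Longrightarrow> subspace (U i)" and "\<And>i. i < r \<Longrightarrow> U i \<subseteq> U (Suc i)"
  shows "quot_dim scale (U r) (U 0) = (\<Sum>i<r. quot_dim scale (U (Suc i)) (U i))"
  using assms
proof (induction r)
  case 0
  then show ?case by (simp add: quot_dim_self)
next
  case (Suc r)
  have "j \<le> r \<Longrightarrow> U 0 \<subseteq> U j" for j
    using Suc.prems(2) by (induction j) (auto dest!: Suc_leD, meson less_Suc_eq_le subsetD Suc_leD)
  then have "U 0 \<subseteq> U r" by blast
  then have "quot_dim scale (U (Suc r)) (U 0) =
    quot_dim scale (U (Suc r)) (U r) + quot_dim scale (U r) (U 0)"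
    using Suc.prems by (intro quot_dim_add) auto
  then show ?case using Suc by (simp add: add.commute)
qed

lemma quot_dim_pos:
  assumes W: "subspace W" and "v \<in> V" "v \<notin> W"
  shows "1 \<le> quot_dim scale V W"
proof -
  have "enat (card {v}) \<le> quot_dim scale V W"
  proof (rule quot_dim_ge)
    show "indep_mod W {v}" unfolding indep_mod_def
    proof (intro conjI allI impI)
      fix c assume c: "(\<Sum>b\<in>{v}. scale (c b) b) \<in> W"
      have "v \<in> W" if "c v \<noteq> 0" using subspace_scale[OF W c, of "1 / c v"] that by simp
      then show "\<forall>b\<in>{v}. c b = 0" using assms(3) by auto
    qed simp
  qed (use assms in simp)
  then show ?thesis by (simp add: one_enat_def)
qed

lemma quot_dim_strict_chain:
  assumes sub: "\<And>i. i \<le> r \<Longrightarrow> subspace (U i)" and strict: "\<And>i. i < r \<Longrightarrow> U i \<subset> U (Suc i)"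
  shows "enat r \<le> quot_dim scale (U r) (U 0)"
proof -
  have "enat r = (\<Sum>i<r. 1)" by (simp add: of_nat_eq_enat)
  also have "\<dots> \<le> (\<Sum>i<r. quot_dim scale (U (Suc i)) (U i))"
  proof (rule sum_mono)
    fix i assume i: "i \<in> {..<r}"
    then obtain v where "v \<in> U (Suc i)" "v \<notin> U i" using strict[of i] by auto
    then show "1 \<le> quot_dim scale (U (Suc i)) (U i)" using i sub by (intro quot_dim_pos) auto
  qed
  also have "\<dots> = quot_dim scale (U r) (U 0)"
    using assms by (intro quot_dim_chain[symmetric]) auto
  finally show ?thesis .
qed

lemma dim_eq_quot_dim:
  assumes V: "subspace V" and d: "quot_dim scale V {0} = enat d"
  shows "dim V = d"
proof -
  obtain B where B: "indep_mod {0} B" "B \<subseteq> V" "card B = d"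
    "\<And>v. v \<in> V \<Longrightarrow> \<exists>c. v - (\<Sum>b\<in>B. scale (c b) b) \<in> {0}"
    using quot_dim_basis[OF subspace_single_0 d] by blast
  show ?thesis
  proof (rule dim_unique[OF B(2) _ _ B(3)])
    show "V \<subseteq> span B"
    proof
      fix v assume "v \<in> V"
      then obtain c where "v = (\<Sum>b\<in>B. scale (c b) b)" using B(4) by force
      then show "v \<in> span B" by (simp add: span_sum span_scale span_base)
    qed
    show "independent B" using B(1) by (intro independent_if_scalars_zero) (auto simp: indep_mod_def)
  qed
qed

end

text \<open>The hypotheses say that \<open>\<phi>\<close> induces an isomorphism from V/W onto
  V'/W'; injectivity and surjectivity are both stated modulo the subspaces.\<close>

lemma quot_dim_linear:
  assumes lin: "Vector_Spaces.linear scale scale' \<phi>"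
    and W: "module.subspace scale W" and V: "module.subspace scale V"
    and W': "module.subspace scale' W'"
    and V': "\<And>x. x \<in> V \<Longrightarrow> \<phi> x \<in> V'" "\<And>y. y \<in> V' \<Longrightarrow> \<exists>x\<in>V. y - \<phi> x \<in> W'"
    and ker: "\<And>x. x \<in> V \<Longrightarrow> \<phi> x \<in> W' \<longleftrightarrow> x \<in> W"
  shows "quot_dim scale V W = quot_dim scale' V' W'"
proof -
  interpret Vector_Spaces.linear scale scale' \<phi> by fact
  interpret a: complex_vector_space scale ..
  interpret b: complex_vector_space scale' ..
  have sum_in: "(\<Sum>i\<in>S. scale (c i) (x i)) \<in> V" if "\<And>i. i \<in> S \<Longrightarrow> x i \<in> V" for S and x :: "'z \<Rightarrow> _" and c
    using that V by (intro vs1.subspace_sum vs1.subspace_scale) auto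
  have sum_phi: "\<phi> (\<Sum>i\<in>S. scale (c i) (x i)) = (\<Sum>i\<in>S. scale' (c i) (\<phi> (x i)))"
    for S and x :: "'z \<Rightarrow> _" and c
    by (simp add: sum scale)
  show ?thesis
  proof (rule antisym)
    show "quot_dim scale V W \<le> quot_dim scale' V' W'"
    proof (rule a.quot_dim_leI)
      fix B assume B: "a.indep_mod W B" "B \<subseteq> V"
      show "enat (card B) \<le> quot_dim scale' V' W'"
      proof (rule b.quot_dim_ge_family[where v = \<phi>])
        show "finite B" using B by (simp add: a.indep_mod_def)
        fix c assume "(\<Sum>i\<in>B. scale' (c i) (\<phi> i)) \<in> W'"
        then have "\<phi> (\<Sum>i\<in>B. scale (c i) i) \<in> W'" by (simp only: sum_phi)
        moreover have "(\<Sum>i\<in>B. scale (c i) i) \<in> V" using B(2) by (intro sum_in) blast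
        ultimately have "(\<Sum>i\<in>B. scale (c i) i) \<in> W" using ker by blast
        then show "\<forall>i\<in>B. c i = 0" using B by (simp add: a.indep_mod_def)
      qed (use B V' W' in auto)
    qed
    show "quot_dim scale' V' W' \<le> quot_dim scale V W"
    proof (rule b.quot_dim_leI)
      fix B assume B: "b.indep_mod W' B" "B \<subseteq> V'"
      then have "\<forall>y\<in>B. \<exists>x. x \<in> V \<and> y - \<phi> x \<in> W'" using V'(2) by blast
      from bchoice[OF this] obtain x where x: "\<And>y. y \<in> B \<Longrightarrow> x y \<in> V \<and> y - \<phi> (x y) \<in> W'"
        by blast
      show "enat (card B) \<le> quot_dim scale V W"
      proof (rule a.quot_dim_ge_family[where v = x])
        show "finite B" using B by (simp add: b.indep_mod_def)
        fix c assume "(\<Sum>i\<in>B. scale (c i) (x i)) \<in> W"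
        moreover have "(\<Sum>i\<in>B. scale (c i) (x i)) \<in> V" using x by (intro sum_in) blast
        ultimately have "\<phi> (\<Sum>i\<in>B. scale (c i) (x i)) \<in> W'" using ker by blast
        then have 1: "(\<Sum>i\<in>B. scale' (c i) (\<phi> (x i))) \<in> W'" by (simp only: sum_phi)
        have 2: "(\<Sum>i\<in>B. scale' (c i) (i - \<phi> (x i))) \<in> W'"
          using x W' by (intro vs2.subspace_sum vs2.subspace_scale) auto
        have "(\<Sum>i\<in>B. scale' (c i) i) =
          (\<Sum>i\<in>B. scale' (c i) (\<phi> (x i))) + (\<Sum>i\<in>B. scale' (c i) (i - \<phi> (x i)))"
          by (simp add: sum.distrib[symmetric] vs2.scale_right_distrib[symmetric])
        also have "\<dots> \<in> W'" by (rule vs2.subspace_add[OF W' 1 2])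
        finally show "\<forall>i\<in>B. c i = 0" using B by (simp add: b.indep_mod_def)
      qed (use W x in auto)
    qed
  qed
qed

text \<open>A Chinese remainder count: the joint map from \<open>V\<close> to the product of the
  quotients of \<open>V' i\<close> by \<open>W' i\<close> is onto, because \<open>surj\<close>
  reaches each factor separately. It is applied to values at base points, to coefficients and to the
  entries of 4-tuples.\<close>

lemma quot_dim_joint_kernel:
  assumes lin: "\<And>i. i \<in> S \<Longrightarrow> Vector_Spaces.linear scale scale' (\<phi> i)" and S: "finite S"
    and V: "module.subspace scale V" and vs: "vector_space scale"
    and W': "\<And>i. i \<in> S \<Longrightarrow> module.subspace scale' (W' i)"
    and V': "\<And>i x. i \<in> S \<Longrightarrow> x \<in> V \<Longrightarrow> \<phi> i x \<in> V' i"
    and surj: "\<And>i y. i \<in> S \<Longrightarrow> y \<in> V' i \<Longrightarrow>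
      \<exists>x\<in>V. y - \<phi> i x \<in> W' i \<and> (\<forall>j\<in>S - {i}. \<phi> j x \<in> W' j)"
  shows "quot_dim scale V {x \<in> V. \<forall>i\<in>S. \<phi> i x \<in> W' i} = (\<Sum>i\<in>S. quot_dim scale' (V' i) (W' i))"
proof -
  interpret complex_vector_space scale using vs by (rule complex_vector_space.intro)
  let ?K = "\<lambda>T. {x \<in> V. \<forall>i\<in>T. \<phi> i x \<in> W' i}"
  have sub: "subspace (?K T)" if "T \<subseteq> S" for T
  proof (rule subspaceI)
    show "0 \<in> ?K T"
    proof -
      have "\<phi> i 0 \<in> W' i" if i: "i \<in> S" for i
      proof -
        interpret l: Vector_Spaces.linear scale scale' "\<phi> i" by (rule lin[OF i])
        show ?thesis using W'[OF i] by (simp add: l.zero l.vs2.subspace_0)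
      qed
      then show ?thesis using that V by (auto simp: subspace_0)
    qed
  next
    fix x y assume xy: "x \<in> ?K T" "y \<in> ?K T"
    have "\<phi> i (x + y) \<in> W' i" if i: "i \<in> T" for i
    proof -
      interpret l: Vector_Spaces.linear scale scale' "\<phi> i" using lin i \<open>T \<subseteq> S\<close> by auto
      show ?thesis using W'[of i] xy i \<open>T \<subseteq> S\<close> by (auto simp: l.add intro!: l.vs2.subspace_add)
    qed
    then show "x + y \<in> ?K T" using xy V by (auto simp: subspace_add)
  next
    fix c x assume xy: "x \<in> ?K T"
    have "\<phi> i (scale c x) \<in> W' i" if i: "i \<in> T" for i
    proof -
      interpret l: Vector_Spaces.linear scale scale' "\<phi> i" using lin i \<open>T \<subseteq> S\<close> by auto
      show ?thesis using W'[of i] xy i \<open>T \<subseteq> S\<close> by (auto simp: l.scale intro!: l.vs2.subspace_scale)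
    qed
    then show "scale c x \<in> ?K T" using xy V by (auto simp: subspace_scale)
  qed
  \<comment> \<open>The conditions are imposed one index at a time. By \<open>surj\<close> the map
    \<open>\<phi> i\<close> is still onto modulo \<open>W' i\<close> on \<open>?K T\<close>, so the
    new condition costs exactly one factor.\<close>
  have "quot_dim scale V (?K T) = (\<Sum>i\<in>T. quot_dim scale' (V' i) (W' i))" if "T \<subseteq> S" for T
    using finite_subset[OF that S] that
  proof (induction T rule: finite_induct)
    case empty
    then show ?case using quot_dim_self[OF V] by simp
  next
    case (insert i T)
    have "quot_dim scale (?K T) (?K (insert i T)) = quot_dim scale' (V' i) (W' i)"
    proof (rule quot_dim_linear[of _ _ "\<phi> i"])
      show "\<exists>x\<in>?K T. y - \<phi> i x \<in> W' i" if "y \<in> V' i" for y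
        using surj[of i y] that insert by fastforce
    qed (use insert lin W' V' sub[of T] sub[of "insert i T"] in auto)
    moreover have "quot_dim scale V (?K (insert i T)) =
        quot_dim scale V (?K T) + quot_dim scale (?K T) (?K (insert i T))"
      using insert.prems by (intro quot_dim_add sub V) auto
    ultimately show ?case using insert by (simp add: add.commute)
  qed
  then show ?thesis by blast
qed


section \<open>Ideals of finite colength in a local ring with residue field C\<close>

text \<open>A local ring \<open>A\<close> inside a field, with maximal ideal \<open>M\<close> and
  with C embedded by \<open>\<kappa>\<close>. The axiom \<open>residue\<close> says that the residue
  field is C, which turns lengths into complex dimensions.\<close>

locale local_subalgebra =
  fixes A M :: "'a::field set" and \<kappa> :: "complex \<Rightarrow> 'a"
  assumes A_add: "x \<in> A \<Longrightarrow> y \<in> A \<Longrightarrow> x + y \<in> A"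
    and A_mult: "x \<in> A \<Longrightarrow> y \<in> A \<Longrightarrow> x * y \<in> A"
    and \<kappa>_A: "\<kappa> c \<in> A" and \<kappa>_1: "\<kappa> 1 = 1"
    and \<kappa>_add: "\<kappa> (c + d) = \<kappa> c + \<kappa> d" and \<kappa>_mult: "\<kappa> (c * d) = \<kappa> c * \<kappa> d"
    and M_A: "M \<subseteq> A" and M_add: "x \<in> M \<Longrightarrow> y \<in> M \<Longrightarrow> x + y \<in> M"
    and M_mult: "x \<in> A \<Longrightarrow> y \<in> M \<Longrightarrow> x * y \<in> M" and one_notin_M: "1 \<notin> M"
    and residue: "x \<in> A \<Longrightarrow> \<exists>c. x - \<kappa> c \<in> M"
    and A_inverse: "x \<in> A \<Longrightarrow> x \<notin> M \<Longrightarrow> inverse x \<in> A"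
begin

lemma \<kappa>_0: "\<kappa> 0 = 0"
  using \<kappa>_add[of 0 0] by (metis add.right_neutral add_left_cancel)

lemma \<kappa>_minus_1: "\<kappa> (- 1) = - 1"
  using \<kappa>_add[of 1 "- 1"] by (simp add: \<kappa>_0 \<kappa>_1 eq_neg_iff_add_eq_0 add.commute)

lemma A_0: "0 \<in> A" and A_1: "1 \<in> A"
  using \<kappa>_A \<kappa>_0 \<kappa>_1 by metis+

lemma A_minus: "x \<in> A \<Longrightarrow> - x \<in> A"
  using A_mult[OF \<kappa>_A[of "- 1"]] by (simp add: \<kappa>_minus_1)

lemma A_diff: "x \<in> A \<Longrightarrow> y \<in> A \<Longrightarrow> x - y \<in> A"
  using A_add[OF _ A_minus] by fastforce

lemma A_power: "x \<in> A \<Longrightarrow> x ^ i \<in> A"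
  by (induction i) (auto intro: A_1 A_mult)

lemmas A_closed = A_0 A_1 A_add A_mult A_minus A_diff A_power

abbreviation smult :: "complex \<Rightarrow> 'a \<Rightarrow> 'a" where
  "smult c x \<equiv> \<kappa> c * x"

sublocale vs: complex_vector_space smult
  by unfold_locales (simp_all add: algebra_simps \<kappa>_add \<kappa>_mult \<kappa>_1)

definition ring_of :: "'a ring" where
  "ring_of = \<lparr>carrier = A, monoid.mult = (*), one = 1, zero = 0, add = (+)\<rparr>"

lemma ring_of_simps [simp]:
  "carrier ring_of = A" "x \<otimes>\<^bsub>ring_of\<^esub> y = x * y" "x \<oplus>\<^bsub>ring_of\<^esub> y = x + y"
  "\<one>\<^bsub>ring_of\<^esub> = 1" "\<zero>\<^bsub>ring_of\<^esub> = 0"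
  by (simp_all add: ring_of_def)

lemma ring_ring_of: "ring ring_of"
  by (rule ringI; (rule abelian_groupI monoidI)?)
     (auto simp: A_closed algebra_simps intro!: bexI[of _ "- x" for x])

text \<open>Ideals as plain subsets of the field, free of ring records; \<open>ideal_iff\<close> is
  the bridge to \<open>quot_length\<close> and to generated ideals.\<close>

definition is_ideal :: "'a set \<Rightarrow> bool" where
  "is_ideal J \<longleftrightarrow> J \<subseteq> A \<and> 0 \<in> J \<and> (\<forall>x\<in>J. \<forall>y\<in>J. x + y \<in> J) \<and> (\<forall>x\<in>A. \<forall>y\<in>J. x * y \<in> J)"

lemma is_idealD:
  assumes "is_ideal J"
  shows "J \<subseteq> A" "0 \<in> J" "x \<in> J \<Longrightarrow> y \<in> J \<Longrightarrow> x + y \<in> J" "x \<in> A \<Longrightarrow> y \<in> J \<Longrightarrow> x * y \<in> J"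
  using assms by (auto simp: is_ideal_def)

lemma is_ideal_subspace: "is_ideal J \<Longrightarrow> vs.subspace J"
  by (rule vs.subspaceI) (auto simp: is_ideal_def \<kappa>_A)

lemma is_ideal_A: "is_ideal A"
  by (auto simp: is_ideal_def A_closed)

lemma ideal_iff: "ideal J ring_of \<longleftrightarrow> is_ideal J"
proof
  assume "ideal J ring_of"
  then interpret ideal J ring_of .
  show "is_ideal J"
    using a_subset additive_subgroup.zero_closed[OF is_additive_subgroup] 
      additive_subgroup.a_closed[OF is_additive_subgroup] I_l_closed
    by (auto simp: is_ideal_def)
next
  assume J: "is_ideal J"
  interpret ring ring_of by (rule ring_ring_of)
  show "ideal J ring_of"
  proof (rule idealI[OF ring_ring_of])
    show "subgroup J (add_monoid ring_of)"
    proof (rule add.subgroupI)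
      show "J \<noteq> {}" using is_idealD(2)[OF J] by auto
      fix a assume a: "a \<in> J"
      have "\<ominus>\<^bsub>ring_of\<^esub> a = - a"
        using is_idealD(1)[OF J] a by (intro minus_equality) (auto simp: A_closed)
      then show "\<ominus>\<^bsub>ring_of\<^esub> a \<in> J"
        using is_idealD(4)[OF J, of "- 1" a] a by (simp add: A_closed)
    qed (use is_idealD[OF J] in auto)
    show "x \<otimes>\<^bsub>ring_of\<^esub> a \<in> J" "a \<otimes>\<^bsub>ring_of\<^esub> x \<in> J"
      if "a \<in> J" "x \<in> carrier ring_of" for a x
      using is_idealD(4)[OF J, of x a] that by (simp_all add: mult.commute)
  qed
qed

text \<open>Nakayama for a single element: \<open>1 - z\<close> lies outside \<open>M\<close>, hence
  is a unit of \<open>A\<close>, and its product with \<open>x\<close> lies in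
  \<open>J\<close>.\<close>

lemma nakayama:
  assumes J: "is_ideal J" and z: "z \<in> M" and x: "x - z * x \<in> J"
  shows "x \<in> J"
proof -
  have "1 - z \<in> A" using z M_A by (auto intro: A_closed)
  moreover have "1 - z \<notin> M" using M_add[of "1 - z" z] z one_notin_M by auto
  ultimately have "inverse (1 - z) \<in> A" by (rule A_inverse)
  then have "inverse (1 - z) * ((1 - z) * x) \<in> J"
    using x by (intro is_idealD(4)[OF J, of "inverse (1 - z)"]) (simp_all only: left_diff_distrib mult_1)
  moreover have "1 - z \<noteq> 0" using z one_notin_M by auto
  then have "inverse (1 - z) * ((1 - z) * x) = x" by (metis left_inverse mult.assoc mult_1)
  ultimately show ?thesis by simp
qed

definition adjoin :: "'a set \<Rightarrow> 'a \<Rightarrow> 'a set" where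
  "adjoin J x = {j + a * x | j a. j \<in> J \<and> a \<in> A}"

lemma adjoin_ideal:
  assumes J: "is_ideal J" and x: "x \<in> A"
  shows "is_ideal (adjoin J x)" "J \<subseteq> adjoin J x" "x \<in> adjoin J x"
proof -
  note JD = is_idealD[OF J]
  have "J \<subseteq> A" by (rule JD(1))
  show "J \<subseteq> adjoin J x"
  proof
    fix j assume "j \<in> J"
    moreover have "j = j + 0 * x" by simp
    ultimately show "j \<in> adjoin J x" unfolding adjoin_def using A_0 by blast
  qed
  show "x \<in> adjoin J x"
  proof -
    have "x = 0 + 1 * x" by simp
    then show ?thesis unfolding adjoin_def using JD(2) A_1 by blast
  qed
  show "is_ideal (adjoin J x)" unfolding is_ideal_def
  proof (intro conjI ballI)
    show "adjoin J x \<subseteq> A" using \<open>J \<subseteq> A\<close> x by (auto simp: adjoin_def A_closed)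
    show "0 \<in> adjoin J x" using JD(2) \<open>J \<subseteq> adjoin J x\<close> by blast
  next
    fix u v assume "u \<in> adjoin J x" "v \<in> adjoin J x"
    then obtain i a j b where *: "u = i + a * x" "v = j + b * x" "i \<in> J" "j \<in> J" "a \<in> A" "b \<in> A"
      unfolding adjoin_def by blast
    then have "u + v = (i + j) + (a + b) * x" by (simp add: algebra_simps)
    then show "u + v \<in> adjoin J x" unfolding adjoin_def using * JD(3) A_add by blast
  next
    fix u v assume u: "u \<in> A" and "v \<in> adjoin J x"
    then obtain j b where *: "v = j + b * x" "j \<in> J" "b \<in> A"
      unfolding adjoin_def by blast
    then have "u * v = u * j + (u * b) * x" by (simp add: algebra_simps)
    then show "u * v \<in> adjoin J x" unfolding adjoin_def using * u JD(4) A_mult by blast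
  qed
qed

lemma quot_dim_ideal_add:
  "is_ideal V \<Longrightarrow> is_ideal U \<Longrightarrow> is_ideal W \<Longrightarrow> W \<subseteq> U \<Longrightarrow> U \<subseteq> V \<Longrightarrow>
    quot_dim smult V W = quot_dim smult V U + quot_dim smult U W"
  by (intro vs.quot_dim_add is_ideal_subspace)

text \<open>If \<open>x\<close> generates the smallest ideal above \<open>J\<close>, then by Nakayama the maximal ideal kills
  \<open>x\<close> modulo \<open>J\<close>, so that this ideal is \<open>J\<close> plus the line through \<open>x\<close>.\<close>

lemma ideal_one_step:
  assumes J: "is_ideal J" and d: "quot_dim smult A J = enat (Suc d)"
  obtains K where "is_ideal K" "J \<subset> K" "quot_dim smult A K = enat d"
proof -
  note JD = is_idealD[OF J]
  have fin: "\<exists>e. quot_dim smult (adjoin J x) J = enat e" if "x \<in> A" for x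
  proof -
    have "quot_dim smult (adjoin J x) J \<le> quot_dim smult A J"
      using adjoin_ideal(1)[OF J that] by (intro vs.quot_dim_mono) (auto simp: is_ideal_def)
    then show ?thesis using d by (auto dest: enat_ile)
  qed
  have "\<exists>x. x \<in> A \<and> x \<notin> J"
  proof (rule ccontr)
    assume "\<not> ?thesis"
    then have "A = J" using JD(1) by auto
    then show False using d vs.quot_dim_self[OF is_ideal_subspace[OF J]] by (simp add: zero_enat_def)
  qed
  \<comment> \<open>The least dimension stands for a smallest ideal above \<open>J\<close>. By
    \<open>fin\<close> all dimensions compared here are finite, so \<open>the_enat\<close> is
    faithful.\<close>
  then obtain x where x: "x \<in> A" "x \<notin> J" and min: "\<And>y. y \<in> A \<Longrightarrow> y \<notin> J \<Longrightarrow>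
      the_enat (quot_dim smult (adjoin J x) J) \<le> the_enat (quot_dim smult (adjoin J y) J)"
    using ex_has_least_nat[of "\<lambda>x. x \<in> A \<and> x \<notin> J" _ "\<lambda>x. the_enat (quot_dim smult (adjoin J x) J)"]
    by blast
  let ?K = "adjoin J x"
  note K = adjoin_ideal[OF J x(1)]
  have kill: "z * x \<in> J" if z: "z \<in> M" for z
  proof (rule ccontr)
    assume n: "z * x \<notin> J"
    have zx: "z * x \<in> A" using z M_A x by (auto intro: A_mult)
    let ?L = "adjoin J (z * x)"
    note L = adjoin_ideal[OF J zx]
    have LK: "?L \<subseteq> ?K"
    proof
      fix v assume "v \<in> ?L"
      then obtain j a where "v = j + a * (z * x)" "j \<in> J" "a \<in> A" by (auto simp: adjoin_def)
      moreover have "a * z \<in> A" using \<open>a \<in> A\<close> z M_A by (auto intro: A_mult)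
      moreover have "v = j + (a * z) * x" using calculation by (simp add: mult.assoc)
      ultimately show "v \<in> ?K" unfolding adjoin_def by blast
    qed
    \<comment> \<open>Otherwise \<open>x\<close> would be congruent modulo \<open>J\<close> to a
      multiple of itself by an element of \<open>M\<close>. Thus \<open>?L\<close> is strictly
      smaller than \<open>?K\<close>, against the choice of \<open>x\<close>.\<close>
    have "x \<notin> ?L"
    proof
      assume "x \<in> ?L"
      then obtain j a where "x = j + a * (z * x)" "j \<in> J" "a \<in> A" by (auto simp: adjoin_def)
      then have "x - (a * z) * x \<in> J" by (metis add_diff_cancel_right' mult.assoc)
      then show False using nakayama[OF J M_mult[OF \<open>a \<in> A\<close> z]] x by blast
    qed
    then have "1 \<le> quot_dim smult ?K ?L"
      using K(3) by (intro vs.quot_dim_pos is_ideal_subspace L(1))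
    moreover have "quot_dim smult ?K J = quot_dim smult ?K ?L + quot_dim smult ?L J"
      by (rule quot_dim_ideal_add[OF K(1) L(1) J L(2) LK])
    moreover obtain e e' where "quot_dim smult ?K J = enat e" "quot_dim smult ?L J = enat e'"
      using fin x(1) zx by metis
    moreover from calculation(3,4) have "e \<le> e'" using min[OF zx n] by simp
    ultimately show False by (cases "quot_dim smult ?K ?L") (auto simp: one_enat_def)
  qed
  have "quot_dim smult ?K J \<le> enat (card {x})"
  proof (rule vs.quot_dim_le_card[OF is_ideal_subspace[OF J]])
    fix v assume "v \<in> ?K"
    then obtain j a where v: "v = j + a * x" "j \<in> J" "a \<in> A" by (auto simp: adjoin_def)
    obtain c where "a - \<kappa> c \<in> M" using residue[OF v(3)] by blast
    then have "j + (a - \<kappa> c) * x \<in> J" using v kill JD(3) by blast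
    then show "\<exists>c. v - (\<Sum>b\<in>{x}. smult (c b) b) \<in> J"
      using v by (intro exI[of _ "\<lambda>_. c"]) (simp add: algebra_simps)
  qed simp
  moreover have "1 \<le> quot_dim smult ?K J"
    using K(3) x(2) by (intro vs.quot_dim_pos is_ideal_subspace J)
  ultimately have "quot_dim smult ?K J = 1" by (simp add: one_enat_def)
  moreover have "quot_dim smult A J = quot_dim smult A ?K + quot_dim smult ?K J"
    using is_idealD(1)[OF K(1)] by (intro quot_dim_ideal_add is_ideal_A K J)
  ultimately have "quot_dim smult A ?K = enat d"
    using d by (cases "quot_dim smult A ?K") (auto simp: one_enat_def)
  then show ?thesis using that K x(2) by blast
qed

lemma ideal_chain_exists:
  assumes "is_ideal J" and "quot_dim smult A J = enat d"
  shows "\<exists>C. (\<forall>i\<le>d. is_ideal (C i) \<and> J \<subseteq> C i) \<and> (\<forall>i<d. C i \<subset> C (Suc i))"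
  using assms
proof (induction d arbitrary: J)
  case 0
  then show ?case by (intro exI[of _ "\<lambda>_. J"]) auto
next
  case (Suc d)
  obtain K where K: "is_ideal K" "J \<subset> K" "quot_dim smult A K = enat d"
    using ideal_one_step[OF Suc.prems] by blast
  obtain C where C: "\<forall>i\<le>d. is_ideal (C i) \<and> K \<subseteq> C i" "\<forall>i<d. C i \<subset> C (Suc i)"
    using Suc.IH[OF K(1,3)] by blast
  let ?C = "case_nat J C"
  have "is_ideal (?C i) \<and> J \<subseteq> ?C i" if "i \<le> Suc d" for i
    using that C(1) K(2) Suc.prems(1) by (cases i) auto
  moreover have "J \<subset> C 0" using C(1) K(2) by blast
  then have "?C i \<subset> ?C (Suc i)" if "i < Suc d" for i
    using that C(2) by (cases i) auto
  ultimately show ?case by blast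
qed

text \<open>Strict chains of ideals are strict chains of subspaces, so no chain is longer than the
  dimension; \<open>ideal_chain_exists\<close> provides one of that length.\<close>

lemma quot_length_eq:
  assumes J: "is_ideal J" and d: "quot_dim smult A J = enat d"
  shows "quot_length ring_of J = enat d"
  unfolding quot_length_def ideal_iff
proof (rule antisym)
  show "enat d \<le> Sup {enat r |r. \<exists>C. (\<forall>i\<le>r. is_ideal (C i) \<and> J \<subseteq> C i) \<and> (\<forall>i<r. C i \<subset> C (Suc i))}"
    using ideal_chain_exists[OF J d] by (intro Sup_upper) blast
  show "Sup {enat r |r. \<exists>C. (\<forall>i\<le>r. is_ideal (C i) \<and> J \<subseteq> C i) \<and> (\<forall>i<r. C i \<subset> C (Suc i))} \<le> enat d"
  proof (rule Sup_least)
    fix x assume "x \<in> {enat r |r. \<exists>C. (\<forall>i\<le>r. is_ideal (C i) \<and> J \<subseteq> C i) \<and> (\<forall>i<r. C i \<subset> C (Suc i))}"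
    then obtain r C where C: "x = enat r" "\<forall>i\<le>r. is_ideal (C i) \<and> J \<subseteq> C i" "\<forall>i<r. C i \<subset> C (Suc i)"
      by blast
    then have "x \<le> quot_dim smult (C r) (C 0)"
      unfolding C(1) by (intro vs.quot_dim_strict_chain is_ideal_subspace) auto
    also have "\<dots> \<le> quot_dim smult A J" using C(2) by (intro vs.quot_dim_mono) (auto simp: is_ideal_def)
    finally show "x \<le> enat d" using d by simp
  qed
qed

text \<open>If no power of \<open>z\<close> lies in \<open>J\<close>, then by Nakayama the ideals
  generated by \<open>J\<close> and the successive powers of \<open>z\<close> decrease strictly,
  which is impossible in finite colength.\<close>

lemma nilpotent_mod_ideal:
  assumes J: "is_ideal J" and d: "quot_dim smult A J = enat d" and z: "z \<in> M"
  shows "\<exists>N. z ^ N \<in> J"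
proof (rule ccontr)
  assume n: "\<nexists>N. z ^ N \<in> J"
  have zA: "z ^ i \<in> A" for i using z M_A by (auto intro: A_power)
  let ?K = "\<lambda>i. adjoin J (z ^ i)"
  note K = adjoin_ideal[OF J zA]
  have strict: "?K (Suc i) \<subset> ?K i" for i
  proof -
    have "?K (Suc i) \<subseteq> ?K i"
    proof
      fix v assume "v \<in> ?K (Suc i)"
      then obtain j a where "v = j + (a * z) * z ^ i" "j \<in> J" "a \<in> A"
        by (auto simp: adjoin_def mult.assoc)
      moreover have "a * z \<in> A" using \<open>a \<in> A\<close> z M_A by (auto intro: A_mult)
      ultimately show "v \<in> ?K i" unfolding adjoin_def by blast
    qed
    moreover have "z ^ i \<notin> ?K (Suc i)"
    proof
      assume "z ^ i \<in> ?K (Suc i)"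
      then obtain j a where "z ^ i = j + (a * z) * z ^ i" "j \<in> J" "a \<in> A"
        by (auto simp: adjoin_def mult.assoc)
      then have "z ^ i - (a * z) * z ^ i \<in> J" by (metis add_diff_cancel_right')
      then show False using nakayama[OF J M_mult[OF \<open>a \<in> A\<close> z]] n by blast
    qed
    ultimately show ?thesis using K(3) by blast
  qed
  \<comment> \<open>The decreasing chain read backwards: it has \<open>d + 1\<close> strict steps,
    one more than dimension \<open>d\<close> allows.\<close>
  define C where "C i = ?K (Suc d - i)" for i
  have "enat (Suc d) \<le> quot_dim smult (C (Suc d)) (C 0)"
  proof (rule vs.quot_dim_strict_chain)
    show "vs.subspace (C i)" for i unfolding C_def by (rule is_ideal_subspace[OF K(1)])
    show "C i \<subset> C (Suc i)" if "i < Suc d" for i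
      using strict[of "d - i"] that unfolding C_def by (simp add: Suc_diff_le)
  qed
  also have "\<dots> \<le> quot_dim smult A J"
    unfolding C_def by (intro vs.quot_dim_mono K(2) is_idealD(1)[OF K(1)])
  finally show False using d by simp
qed

section \<open>Powers of an ideal with two generators\<close>

lemma genideal_two:
  assumes f: "f \<in> A" and g: "g \<in> A"
  shows "Idl\<^bsub>ring_of\<^esub> {f, g} = {f * a + b * g | a b. a \<in> A \<and> b \<in> A}"
proof -
  let ?J = "{f * a + b * g | a b. a \<in> A \<and> b \<in> A}"
  have eq: "?J = adjoin (adjoin {0} f) g"
    by (auto simp: adjoin_def mult.commute)
  have z: "is_ideal {0}" by (auto simp: is_ideal_def A_0)
  note J1 = adjoin_ideal[OF z f]
  note J = adjoin_ideal[OF J1(1) g]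
  show ?thesis unfolding eq
  proof (rule antisym)
    show "Idl\<^bsub>ring_of\<^esub> {f, g} \<subseteq> adjoin (adjoin {0} f) g"
      unfolding genideal_def ideal_iff using J J1(3) by (intro Inter_lower) auto
    show "adjoin (adjoin {0} f) g \<subseteq> Idl\<^bsub>ring_of\<^esub> {f, g}"
      unfolding genideal_def ideal_iff
      by (auto simp: is_ideal_def adjoin_def)
  qed
qed

text \<open>The powers of the ideal generated by \<open>f\<close> and \<open>g\<close>: every
  monomial of degree \<open>j + 1\<close> in \<open>f\<close> and \<open>g\<close> other than
  \<open>g ^ Suc j\<close> is divisible by \<open>f\<close>. This splitting is the one that the
  length count exploits.\<close>

fun ideal_power :: "'a \<Rightarrow> 'a \<Rightarrow> nat \<Rightarrow> 'a set" where
  "ideal_power f g 0 = A"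
| "ideal_power f g (Suc j) = {f * p + c * g ^ Suc j | p c. p \<in> ideal_power f g j \<and> c \<in> A}"

context
  fixes f g :: 'a
  assumes f: "f \<in> A" and g: "g \<in> A"
begin

text \<open>Two values of \<open>h\<close> occur: \<open>g ^ Suc j\<close> gives the next power, and
  \<open>g ^ Suc (Suc j)\<close> gives the intermediate ideal of
  \<open>quot_dim_ideal_power_step\<close>.\<close>

lemma ideal_power_add_multiples:
  assumes P: "is_ideal P" and h: "h \<in> A"
  shows "is_ideal {f * p + c * h | p c. p \<in> P \<and> c \<in> A}"
proof -
  note PD = is_idealD[OF P]
  show ?thesis unfolding is_ideal_def
  proof (intro conjI ballI)
    show "{f * p + c * h | p c. p \<in> P \<and> c \<in> A} \<subseteq> A" using PD(1) f h by (auto intro!: A_closed)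
    show "0 \<in> {f * p + c * h | p c. p \<in> P \<and> c \<in> A}" using PD(2) A_0 by force
  next
    fix u v assume "u \<in> {f * p + c * h | p c. p \<in> P \<and> c \<in> A}" "v \<in> {f * p + c * h | p c. p \<in> P \<and> c \<in> A}"
    then obtain p c q d where *: "u = f * p + c * h" "v = f * q + d * h" "p \<in> P" "q \<in> P" "c \<in> A" "d \<in> A"
      by blast
    then have "u + v = f * (p + q) + (c + d) * h" by (simp add: algebra_simps)
    then show "u + v \<in> {f * p + c * h | p c. p \<in> P \<and> c \<in> A}" using * PD(3) A_add by blast
  next
    fix u v assume u: "u \<in> A" and "v \<in> {f * p + c * h | p c. p \<in> P \<and> c \<in> A}"
    then obtain q d where *: "v = f * q + d * h" "q \<in> P" "d \<in> A"
      by blast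
    then have "u * v = f * (u * q) + (u * d) * h" by (simp add: algebra_simps)
    then show "u * v \<in> {f * p + c * h | p c. p \<in> P \<and> c \<in> A}" using * u PD(4) A_mult by blast
  qed
qed

lemma ideal_power_ideal: "is_ideal (ideal_power f g j)"
proof (induction j)
  case (Suc j)
  show ?case unfolding ideal_power.simps
    by (rule ideal_power_add_multiples[OF Suc A_power[OF g]])
qed (simp add: is_ideal_A)

lemma ideal_power_f: "p \<in> ideal_power f g j \<Longrightarrow> f * p \<in> ideal_power f g (Suc j)"
  using A_0 by force

lemma ideal_power_g: "p \<in> ideal_power f g j \<Longrightarrow> g * p \<in> ideal_power f g (Suc j)"
proof (induction j arbitrary: p)
  case 0
  then have "g * p = f * 0 + p * g ^ Suc 0" by simp
  then show ?case using 0 A_0 by (subst ideal_power.simps) (simp only: ideal_power.simps(1), blast)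
next
  case (Suc j)
  then obtain q c where p: "p = f * q + c * g ^ Suc j" "q \<in> ideal_power f g j" "c \<in> A" by auto
  then have "g * p = f * (g * q) + c * g ^ Suc (Suc j)" by (simp add: algebra_simps)
  with Suc.IH[OF p(2)] p(3) show ?case by (subst ideal_power.simps) blast
qed

lemma power_in_ideal_power: "g ^ j \<in> ideal_power f g j"
proof (induction j)
  case (Suc j)
  show ?case using ideal_power_g[OF Suc] by (simp only: power_Suc)
qed (simp add: A_1)

lemma ideal_power_Suc_subset: "ideal_power f g (Suc j) \<subseteq> ideal_power f g j"
proof
  fix x assume "x \<in> ideal_power f g (Suc j)"
  then obtain p c where x: "x = f * p + (c * g) * g ^ j" "p \<in> ideal_power f g j" "c \<in> A"
    by (auto simp: mult.assoc)
  note P = is_idealD[OF ideal_power_ideal[of j]]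
  show "x \<in> ideal_power f g j"
    unfolding x(1) using x f g power_in_ideal_power by (intro P(3,4) A_mult)
qed

lemma ideal_power_eq:
  "(Idl\<^bsub>ring_of\<^esub> {f, g}) [^]\<^bsub>ideals_set ring_of\<^esub> j = ideal_power f g j"
proof (induction j)
  case 0
  then show ?case by (simp add: nat_pow_def ideals_set_def)
next
  case (Suc j)
  let ?I = "Idl\<^bsub>ring_of\<^esub> {f, g}"
  have "?I [^]\<^bsub>ideals_set ring_of\<^esub> Suc j = ideal_prod ring_of (ideal_power f g j) ?I"
    using Suc by (simp add: nat_pow_def ideals_set_def)
  also have "\<dots> = ideal_power f g (Suc j)"
  proof (rule antisym; rule subsetI)
    note P = is_idealD[OF ideal_power_ideal[of "Suc j"]]
    fix x assume "x \<in> ideal_prod ring_of (ideal_power f g j) ?I"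
    then show "x \<in> ideal_power f g (Suc j)"
    proof (induction rule: ideal_prod.induct)
      case (prod p i)
      then obtain a b where i: "i = f * a + b * g" "a \<in> A" "b \<in> A" by (auto simp: genideal_two[OF f g])
      have "p \<otimes>\<^bsub>ring_of\<^esub> i = a * (f * p) + b * (g * p)" using i(1) by (simp add: algebra_simps)
      also have "\<dots> \<in> ideal_power f g (Suc j)"
        using prod(1) i by (intro P(3,4) ideal_power_f ideal_power_g)
      finally show ?case .
    next
      case (sum s1 s2)
      then show ?case using P(3) by (simp only: ring_of_simps)
    qed
  next
    fix x assume "x \<in> ideal_power f g (Suc j)"
    \<comment> \<open>The last summand is split as \<open>c * g ^ j\<close> times \<open>g\<close>,
      so that both summands are products of an element of the j-th power and a generator.\<close>
    then obtain p c where x: "x = p * f + (c * g ^ j) * g" "p \<in> ideal_power f g j" "c \<in> A"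
      by (auto simp: algebra_simps)
    have fg: "f \<in> ?I" "g \<in> ?I" unfolding genideal_def by auto
    have "c * g ^ j \<in> ideal_power f g j"
      using is_idealD(4)[OF ideal_power_ideal x(3) power_in_ideal_power] .
    then show "x \<in> ideal_prod ring_of (ideal_power f g j) ?I"
      using ideal_prod.sum[OF ideal_prod.prod[OF x(2) fg(1)] ideal_prod.prod[OF _ fg(2)], of "c * g ^ j" ring_of] x(1)
      by simp
  qed
  finally show ?case .
qed

text \<open>The two conditions of a regular sequence: \<open>f\<close> is a nonzerodivisor, and
  \<open>g\<close> is a nonzerodivisor modulo \<open>f\<close>.\<close>

context
  assumes f0: "f \<noteq> 0" and reg: "\<And>c. c \<in> A \<Longrightarrow> g * c \<in> (*) f ` A \<Longrightarrow> c \<in> (*) f ` A"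
begin

lemma regular_power:
  assumes "c \<in> A" "g ^ j * c \<in> (*) f ` A" shows "c \<in> (*) f ` A"
  using assms
proof (induction j)
  case (Suc j)
  have "g ^ j * c \<in> (*) f ` A"
  proof (rule reg)
    show "g ^ j * c \<in> A" by (intro A_mult A_power g Suc.prems(1))
    show "g * (g ^ j * c) \<in> (*) f ` A" using Suc.prems(2) by (simp add: mult.assoc)
  qed
  then show ?case using Suc by blast
qed auto

text \<open>With \<open>U = f I\<^sup>j + A g\<^sup>j\<^sup>+\<^sup>2\<close> between \<open>I\<^sup>j\<^sup>+\<^sup>2\<close> and \<open>I\<^sup>j\<^sup>+\<^sup>1\<close>, multiplication by
  \<open>g\<^sup>j\<^sup>+\<^sup>1\<close> identifies \<open>A / I\<close> with \<open>I\<^sup>j\<^sup>+\<^sup>1 / U\<close>, and multiplication by \<open>f\<close> identifies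
  \<open>I\<^sup>j / I\<^sup>j\<^sup>+\<^sup>1\<close> with \<open>U / I\<^sup>j\<^sup>+\<^sup>2\<close>.\<close>

lemma quot_dim_ideal_power_step:
  "quot_dim smult (ideal_power f g (Suc j)) (ideal_power f g (Suc (Suc j))) =
    quot_dim smult A (ideal_power f g 1) + quot_dim smult (ideal_power f g j) (ideal_power f g (Suc j))"
proof -
  let ?P = "ideal_power f g"
  let ?U = "{f * p + c * g ^ Suc (Suc j) | p c. p \<in> ?P j \<and> c \<in> A}"
  have U: "is_ideal ?U" by (intro ideal_power_add_multiples ideal_power_ideal A_power g)
  note P = ideal_power_ideal
  have lin: "Vector_Spaces.linear smult smult ((*) h)" for h
    by unfold_locales (simp_all add: algebra_simps)
  have UP: "?U \<subseteq> ?P (Suc j)"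
  proof
    fix x assume "x \<in> ?U"
    then obtain p c where x: "x = f * p + c * g ^ Suc (Suc j)" "p \<in> ?P j" "c \<in> A" by blast
    then have "x = f * p + (c * g) * g ^ Suc j" by (simp add: algebra_simps)
    then show "x \<in> ?P (Suc j)" using x(2) A_mult[OF x(3) g] by (subst ideal_power.simps) blast
  qed
  have PU: "?P (Suc (Suc j)) \<subseteq> ?U"
    using ideal_power_Suc_subset[of j] by (subst ideal_power.simps) blast
  have "quot_dim smult (?P (Suc j)) (?P (Suc (Suc j))) =
      quot_dim smult (?P (Suc j)) ?U + quot_dim smult ?U (?P (Suc (Suc j)))"
    by (rule quot_dim_ideal_add[OF P U P PU UP])
  also have "quot_dim smult (?P (Suc j)) ?U = quot_dim smult A (?P 1)"
  proof (rule quot_dim_linear[OF lin[of "g ^ Suc j"], symmetric])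
    fix x assume "x \<in> A"
    then show "g ^ Suc j * x \<in> ?P (Suc j)"
      using is_idealD(4)[OF P _ power_in_ideal_power, of x] by (simp only: mult.commute)
    show "(g ^ Suc j * x \<in> ?U) = (x \<in> ?P 1)"
    proof
      assume "g ^ Suc j * x \<in> ?U"
      then obtain p c where x': "g ^ Suc j * x = f * p + c * g ^ Suc (Suc j)" "p \<in> ?P j" "c \<in> A"
        by blast
      \<comment> \<open>Collecting the powers of \<open>g\<close> on one side leaves a multiple of
        \<open>f\<close>; regularity then cancels \<open>g ^ Suc j\<close>.\<close>
      have "g ^ Suc j * (x - c * g) = f * p" using x'(1) by (simp add: algebra_simps)
      then have "g ^ Suc j * (x - c * g) \<in> (*) f ` A" using x'(2) is_idealD(1)[OF P[of j]] by auto
      then have "x - c * g \<in> (*) f ` A"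
        by (rule regular_power[rotated]) (intro A_diff A_mult \<open>x \<in> A\<close> x'(3) g)
      then obtain q where "q \<in> A" "x - c * g = f * q" by blast
      then have "x = f * q + c * g ^ Suc 0" by (simp add: algebra_simps)
      then show "x \<in> ?P 1" using \<open>q \<in> A\<close> x'(3) by auto
    next
      assume "x \<in> ?P 1"
      then obtain p c where x': "x = f * p + c * g" "p \<in> A" "c \<in> A" by auto
      have "g ^ Suc j * x = f * (p * g ^ Suc j) + c * g ^ Suc (Suc j)"
        using x' by (simp add: algebra_simps)
      moreover have "p * g ^ Suc j \<in> ?P j"
        using is_idealD(4)[OF P x'(2) power_in_ideal_power[of "Suc j"]] ideal_power_Suc_subset by blast
      ultimately show "g ^ Suc j * x \<in> ?U" using x'(3) by blast
    qed
  next
    fix y assume "y \<in> ?P (Suc j)"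
    then obtain p c where y: "y = f * p + c * g ^ Suc j" "p \<in> ?P j" "c \<in> A" by auto
    have "y - g ^ Suc j * c = f * p + 0 * g ^ Suc (Suc j)" using y by (simp add: algebra_simps)
    then have "y - g ^ Suc j * c \<in> ?U" using y(2) A_0 by blast
    then show "\<exists>x\<in>A. y - g ^ Suc j * x \<in> ?U" using y(3) by blast
  qed (intro is_ideal_subspace P U is_ideal_A)+
  also have "quot_dim smult ?U (?P (Suc (Suc j))) = quot_dim smult (?P j) (?P (Suc j))"
  proof (rule quot_dim_linear[OF lin[of f], symmetric])
    fix x assume x: "x \<in> ?P j"
    have "f * x = f * x + 0 * g ^ Suc (Suc j)" by simp
    then show "f * x \<in> ?U" using x A_0 by blast
    show "(f * x \<in> ?P (Suc (Suc j))) = (x \<in> ?P (Suc j))"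
    proof
      assume "f * x \<in> ?P (Suc (Suc j))"
      then obtain p c where x': "f * x = f * p + c * g ^ Suc (Suc j)" "p \<in> ?P (Suc j)" "c \<in> A"
        by (subst (asm) ideal_power.simps) blast
      \<comment> \<open>The same cancellation makes \<open>c\<close> a multiple of \<open>f\<close>,
        after which \<open>f\<close> itself can be cancelled by \<open>f0\<close>.\<close>
      have "g ^ Suc (Suc j) * c = f * (x - p)" using x'(1) by (simp add: algebra_simps)
      moreover have "x - p \<in> A"
        using x x'(2) is_idealD(1)[OF P[of j]] is_idealD(1)[OF P[of "Suc j"]] by (intro A_diff) blast+
      ultimately have "g ^ Suc (Suc j) * c \<in> (*) f ` A" by (simp only: imageI)
      then have "c \<in> (*) f ` A" by (rule regular_power[OF x'(3)])
      then obtain q where q: "q \<in> A" "c = f * q" by blast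
      then have "f * x = f * (p + q * g ^ Suc (Suc j))" using x'(1) by (simp add: algebra_simps)
      then have "x = p + q * g ^ Suc (Suc j)" using f0 by simp
      moreover have "q * g ^ Suc (Suc j) \<in> ?P (Suc j)"
        using is_idealD(4)[OF P q(1) power_in_ideal_power[of "Suc (Suc j)"]] ideal_power_Suc_subset by blast
      ultimately show "x \<in> ?P (Suc j)" using x'(2) is_idealD(3)[OF P] by blast
    qed (rule ideal_power_f)
  next
    fix y assume "y \<in> ?U"
    then obtain p c where y: "y = f * p + c * g ^ Suc (Suc j)" "p \<in> ?P j" "c \<in> A" by blast
    have "y - f * p = c * g ^ Suc (Suc j)" using y by simp
    also have "\<dots> \<in> ?P (Suc (Suc j))" by (rule is_idealD(4)[OF P y(3) power_in_ideal_power])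
    finally show "\<exists>x\<in>?P j. y - f * x \<in> ?P (Suc (Suc j))" using y(2) by blast
  qed (intro is_ideal_subspace P U is_ideal_A)+
  finally show ?thesis .
qed

text \<open>By the preceding recursion the i-th power modulo the next one has dimension
  \<open>d * Suc i\<close>; summing over i < j gives d (1 + ... + j).\<close>

lemma quot_dim_ideal_power:
  assumes d: "quot_dim smult A (ideal_power f g 1) = enat d"
  shows "quot_dim smult A (ideal_power f g j) = enat (d * (\<Sum>i\<le>j. i))"
proof (induction j)
  case 0
  then show ?case using vs.quot_dim_self[OF is_ideal_subspace[OF is_ideal_A]]
    by (simp add: zero_enat_def)
next
  case (Suc j)
  have "quot_dim smult (ideal_power f g j) (ideal_power f g (Suc j)) = enat (d * Suc j)"
  proof (induction j)
    case 0
    then show ?case using d by (simp add: ideal_power.simps(1) del: ideal_power.simps(2))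
  next
    case (Suc j)
    have "quot_dim smult (ideal_power f g (Suc j)) (ideal_power f g (Suc (Suc j))) =
        enat d + enat (d * Suc j)"
      by (simp only: quot_dim_ideal_power_step d Suc)
    then show ?case by simp
  qed
  moreover have "quot_dim smult A (ideal_power f g (Suc j)) =
    quot_dim smult A (ideal_power f g j) + quot_dim smult (ideal_power f g j) (ideal_power f g (Suc j))"
    using is_idealD(1)[OF ideal_power_ideal[of j]]
    by (intro quot_dim_ideal_add is_ideal_A ideal_power_ideal ideal_power_Suc_subset)
  ultimately show ?case using Suc by (simp add: algebra_simps)
qed

lemma multiplicity_regular_sequence:
  assumes d: "quot_dim smult A (Idl\<^bsub>ring_of\<^esub> {f, g}) = enat d"
  shows "lim (\<lambda>j. fact 2 * real (the_enat (quot_length ring_of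
    ((Idl\<^bsub>ring_of\<^esub> {f, g}) [^]\<^bsub>ideals_set ring_of\<^esub> j))) / real j ^ 2) = real d"
proof (rule limI)
  have "ideal_power f g 1 = Idl\<^bsub>ring_of\<^esub> {f, g}" unfolding genideal_two[OF f g] by simp
  then have "quot_dim smult A (ideal_power f g 1) = enat d" using d by simp
  from quot_dim_ideal_power[OF this]
  have len: "quot_length ring_of (ideal_power f g j) = enat (d * (\<Sum>i\<le>j. i))" for j
    by (rule quot_length_eq[OF ideal_power_ideal])
  have gauss: "2 * real (\<Sum>i\<le>j. i) = real j * (real j + 1)" for j
    by (induction j) (simp_all add: algebra_simps)
  \<comment> \<open>The normalised length is d j (j + 1) / j^2 = d + d / j. The equality holds only
    for positive \<open>j\<close>, because division by zero yields 0.\<close>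
  have "(\<lambda>j. real d + real d * inverse (real j)) \<longlonglongrightarrow> real d + real d * 0"
    by (intro tendsto_intros LIMSEQ_inverse_real_of_nat lim_inverse_n)
  moreover have "\<forall>\<^sub>F j in sequentially. real d + real d * inverse (real j) =
      fact 2 * real (the_enat (quot_length ring_of (ideal_power f g j))) / real j ^ 2"
    using eventually_gt_at_top[of 0]
  proof eventually_elim
    case (elim j)
    have "fact 2 * real (the_enat (quot_length ring_of (ideal_power f g j))) =
        real d * (2 * real (\<Sum>i\<le>j. i))" unfolding len by (simp add: fact_2)
    also have "\<dots> = real d * (real j * (real j + 1))" unfolding gauss ..
    finally have len': "fact 2 * real (the_enat (quot_length ring_of (ideal_power f g j))) =
        real d * (real j * (real j + 1))" .
    have "(real d + real d * i) * (real j * real j) = real d * (real j * (real j + 1))"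
      if "i * real j = 1" for i
    proof -
      have "(real d + real d * i) * (real j * real j) =
          real d * real j * real j + real d * real j * (i * real j)"
        by (simp add: algebra_simps)
      then show ?thesis by (simp add: \<open>i * real j = 1\<close> algebra_simps)
    qed
    from this[of "inverse (real j)"] elim show ?case
      unfolding len' power2_eq_square by (subst nonzero_eq_divide_eq) auto
  qed
  ultimately show "(\<lambda>j. fact 2 * real (the_enat (quot_length ring_of
      ((Idl\<^bsub>ring_of\<^esub> {f, g}) [^]\<^bsub>ideals_set ring_of\<^esub> j))) / real j ^ 2) \<longlonglongrightarrow> real d"
    unfolding ideal_power_eq by (auto intro: Lim_transform_eventually)
qed

end

end

end


section \<open>Bihomogeneous polynomials\<close>

text \<open>The monomial c s^i u^j t^k v^l; the exponent of the outermost variable s belongs to the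
  outermost \<open>monom\<close>.\<close>

definition bimon :: "complex \<Rightarrow> nat \<Rightarrow> nat \<Rightarrow> nat \<Rightarrow> nat \<Rightarrow> bipoly" where
  "bimon c i j k l = monom (monom (monom (monom c l) k) j) i"

lemma bicoeff_bimon:
  "bicoeff (bimon c i j k l) i' j' k' l' = (if i = i' \<and> j = j' \<and> k = k' \<and> l = l' then c else 0)"
  by (simp add: bicoeff_def bimon_def)

lemma bipoly_eqI: "(\<And>i j k l. bicoeff f i j k l = bicoeff g i j k l) \<Longrightarrow> f = g"
  unfolding bicoeff_def by (intro poly_eqI) blast

lemma bicoeff_simps [simp]:
  "bicoeff 0 i j k l = 0"
  "bicoeff (f + g) i j k l = bicoeff f i j k l + bicoeff g i j k l"
  "bicoeff (f - g) i j k l = bicoeff f i j k l - bicoeff g i j k l"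
  "bicoeff (bscale c f) i j k l = c * bicoeff f i j k l"
  by (simp_all add: bicoeff_def bscale_def bconst_def)

lemma bicoeff_sum: "bicoeff (\<Sum>x\<in>S. f x) i j k l = (\<Sum>x\<in>S. bicoeff (f x) i j k l)"
  by (simp add: bicoeff_def coeff_sum)

lemma bicoeff_mult:
  "bicoeff (f * g) i j k l = (\<Sum>a\<le>i. \<Sum>b\<le>j. \<Sum>c\<le>k. \<Sum>d\<le>l.
     bicoeff f a b c d * bicoeff g (i - a) (j - b) (k - c) (l - d))"
  by (simp add: bicoeff_def coeff_mult coeff_sum)

lemma bconst_simps:
  "bconst 0 = 0" "bconst 1 = 1" "bconst (c + d) = bconst c + bconst d"
  "bconst (c * d) = bconst c * bconst d"
  by (simp_all add: bconst_def one_pCons)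

lemma vector_space_bscale: "vector_space bscale"
  by unfold_locales (simp_all add: bscale_def bconst_simps algebra_simps)

lemma bihomI: "(\<And>i j k l. bicoeff f i j k l \<noteq> 0 \<Longrightarrow> i + j = d \<and> k + l = e) \<Longrightarrow> f \<in> bihom d e"
  by (simp add: bihom_def)

lemma bihom_0 [simp]: "0 \<in> bihom d e"
  by (rule bihomI) simp

lemma bihom_add: "f \<in> bihom d e \<Longrightarrow> g \<in> bihom d e \<Longrightarrow> f + g \<in> bihom d e"
  unfolding bihom_def by (auto) (metis add.right_neutral add.left_neutral)+

lemma bihom_bscale: "f \<in> bihom d e \<Longrightarrow> bscale c f \<in> bihom d e"
  by (auto simp: bihom_def)

lemma bihom_minus: "f \<in> bihom d e \<Longrightarrow> g \<in> bihom d e \<Longrightarrow> f - g \<in> bihom d e"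
  unfolding bihom_def by auto (metis diff_self)+

lemma bihom_mult:
  assumes f: "f \<in> bihom d e" and g: "g \<in> bihom d' e'"
  shows "f * g \<in> bihom (d + d') (e + e')"
proof (rule bihomI, rule ccontr)
  fix i j k l assume nz: "bicoeff (f * g) i j k l \<noteq> 0" and ne: "\<not> (i + j = d + d' \<and> k + l = e + e')"
  have "bicoeff f a b c h * bicoeff g (i - a) (j - b) (k - c) (l - h) = 0"
    if "a \<le> i" "b \<le> j" "c \<le> k" "h \<le> l" for a b c h
  proof (rule ccontr)
    assume "\<not> ?thesis"
    then have "bicoeff f a b c h \<noteq> 0" "bicoeff g (i - a) (j - b) (k - c) (l - h) \<noteq> 0" by auto
    then have "a + b = d \<and> c + h = e" "(i - a) + (j - b) = d' \<and> (k - c) + (l - h) = e'"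
      using f g unfolding bihom_def by blast+
    then show False using ne that by linarith
  qed
  then have "bicoeff (f * g) i j k l = 0" unfolding bicoeff_mult by (intro sum.neutral ballI) simp
  then show False using nz by simp
qed

lemma bihom_bimon: "bimon c i j k l \<in> bihom (i + j) (k + l)"
  by (auto simp: bihom_def bicoeff_bimon split: if_splits)

lemma bihom_1: "1 \<in> bihom 0 0"
proof -
  have "1 = bimon 1 0 0 0 0" by (simp add: bimon_def monom_0 one_pCons)
  then show ?thesis using bihom_bimon[of 1 0 0 0 0] by simp
qed

lemma bihom_prod:
  assumes "finite S" and "\<And>x. x \<in> S \<Longrightarrow> \<exists>d e. f x \<in> bihom d e"
  shows "\<exists>d e. (\<Prod>x\<in>S. f x) \<in> bihom d e"
  using assms
proof (induction S rule: finite_induct)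
  case empty
  then show ?case using bihom_1 by auto
next
  case (insert x S)
  then obtain d e d' e' where "f x \<in> bihom d e" "(\<Prod>x\<in>S. f x) \<in> bihom d' e'" by blast
  then show ?case using insert bihom_mult by (metis prod.insert)
qed

text \<open>The projection onto the part of bidegree (d, e). A monomial of this bidegree is
  determined by its exponents of s and t, hence the double sum.\<close>

definition component :: "nat \<Rightarrow> nat \<Rightarrow> bipoly \<Rightarrow> bipoly" where
  "component d e f = (\<Sum>i\<le>d. \<Sum>k\<le>e. bimon (bicoeff f i (d - i) k (e - k)) i (d - i) k (e - k))"

lemma bicoeff_component:
  "bicoeff (component d e f) i j k l = (if i + j = d \<and> k + l = e then bicoeff f i j k l else 0)"
proof -
  have "bicoeff (component d e f) i j k l = (\<Sum>i'\<le>d. \<Sum>k'\<le>e.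
      if i' = i then if k' = k then if i + j = d \<and> k + l = e then bicoeff f i j k l else 0 else 0 else 0)"
    unfolding component_def bicoeff_sum bicoeff_bimon by (intro sum.cong refl) auto
  also have "\<dots> = (\<Sum>i'\<le>d. if i' = i then \<Sum>k'\<le>e.
      if k' = k then if i + j = d \<and> k + l = e then bicoeff f i j k l else 0 else 0 else 0)"
    by (intro sum.cong refl) auto
  also have "\<dots> = (if i + j = d \<and> k + l = e then bicoeff f i j k l else 0)"
    by (simp only: sum.delta finite_atMost) auto
  finally show ?thesis .
qed

lemma component_bihom: "component d e f \<in> bihom d e"
  by (auto simp: bihom_def bicoeff_component split: if_splits)

lemma component_add: "component d e (f + g) = component d e f + component d e g"
  by (rule bipoly_eqI) (simp add: bicoeff_component)

lemma component_of_bihom: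
  assumes "f \<in> bihom d e"
  shows "component d' e' f = (if d' = d \<and> e' = e then f else 0)"
  using assms by (intro bipoly_eqI) (auto simp: bicoeff_component bihom_def)

text \<open>Every polynomial is a sum of monomials, unfolded one variable at a time from v outwards.
  Additive statements such as \<open>component_mult\<close> then have to be checked on bihomogeneous
  polynomials only.\<close>

lemma bipoly_induct [case_names bihom add]:
  assumes hom: "\<And>d e f. f \<in> bihom d e \<Longrightarrow> P f" and add: "\<And>f g. P f \<Longrightarrow> P g \<Longrightarrow> P (f + g)"
  shows "P (f :: bipoly)"
proof -
  have sum: "P (\<Sum>x\<in>S. g x)" if "\<And>x. P (g x)" for S :: "nat set" and g
    by (induction S rule: infinite_finite_induct) (auto intro: that add hom[of 0 0 0])
  have 1: "P (monom (monom (monom q k) j) i)" for q k j i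
  proof -
    have "monom (monom (monom q k) j) i =
        (\<Sum>l\<le>degree q. monom (monom (monom (monom (coeff q l) l) k) j) i)"
      by (simp only: monom_sum[symmetric] poly_as_sum_of_monoms)
    also have "P \<dots>" by (intro sum hom) (fold bimon_def, rule bihom_bimon)
    finally show ?thesis .
  qed
  have 2: "P (monom (monom q j) i)" for q j i
  proof -
    have "monom (monom q j) i = (\<Sum>l\<le>degree q. monom (monom (monom (coeff q l) l) j) i)"
      by (simp only: monom_sum[symmetric] poly_as_sum_of_monoms)
    also have "P \<dots>" by (intro sum 1)
    finally show ?thesis .
  qed
  have 3: "P (monom q i)" for q i
  proof -
    have "monom q i = (\<Sum>l\<le>degree q. monom (monom (coeff q l) l) i)"
      by (simp only: monom_sum[symmetric] poly_as_sum_of_monoms)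
    also have "P \<dots>" by (intro sum 2)
    finally show ?thesis .
  qed
  have "f = (\<Sum>l\<le>degree f. monom (coeff f l) l)" by (simp only: poly_as_sum_of_monoms)
  also have "P \<dots>" by (intro sum 3)
  finally show ?thesis .
qed

text \<open>A bihomogeneous factor shifts the bigrading. This is how arbitrary cofactors are
  replaced by bihomogeneous ones in \<open>regular_sequence\<close> and
  \<open>gen_ideal_bihom\<close>.\<close>

lemma component_mult:
  assumes "f \<in> bihom d e"
  shows "component (d + a) (e + b) (f * w) = f * component a b w"
proof (induction w rule: bipoly_induct)
  case (bihom d' e' w)
  show ?case
    by (simp add: component_of_bihom[OF bihom] component_of_bihom[OF bihom_mult[OF assms bihom]])
next
  case (add v w)
  then show ?case by (simp add: distrib_left component_add)
qed

text \<open>Stated for all large \<open>n\<close> so that the bounds of two summands can be merged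
  in the induction.\<close>

lemma sum_components: "\<exists>N. \<forall>n\<ge>N. f = (\<Sum>a\<le>n. \<Sum>b\<le>n. component a b f)"
proof (induction f rule: bipoly_induct)
  case (bihom d e f)
  have "f = (\<Sum>a\<le>n. \<Sum>b\<le>n. component a b f)" if "n \<ge> max d e" for n
  proof -
    have "(\<Sum>a\<le>n. \<Sum>b\<le>n. component a b f) = (\<Sum>a\<le>n. if a = d then \<Sum>b\<le>n. if b = e then f else 0 else 0)"
      by (intro sum.cong refl) (auto simp: component_of_bihom[OF bihom])
    also have "\<dots> = f" using that by (simp add: sum.delta)
    finally show ?thesis by simp
  qed
  then show ?case by blast
next
  case (add f g)
  then obtain M N where "\<forall>n\<ge>M. f = (\<Sum>a\<le>n. \<Sum>b\<le>n. component a b f)"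
    "\<forall>n\<ge>N. g = (\<Sum>a\<le>n. \<Sum>b\<le>n. component a b g)" by blast
  then have "f + g = (\<Sum>a\<le>n. \<Sum>b\<le>n. component a b (f + g))" if "n \<ge> max M N" for n
    using that by (simp add: component_add sum.distrib)
  then show ?case by blast
qed

section \<open>Evaluation and linear forms\<close>

lemma bieval_simps:
  "bieval 0 x y = 0" "bieval 1 x y = 1"
  "bieval (f + g) x y = bieval f x y + bieval g x y"
  "bieval (f - g) x y = bieval f x y - bieval g x y"
  "bieval (f * g) x y = bieval f x y * bieval g x y"
  "bieval (f ^ N) x y = bieval f x y ^ N"
  "bieval (bconst c) x y = c"
  by (simp_all add: bieval_def bconst_def)

lemma bieval_sum: "bieval (\<Sum>i\<in>S. f i) x y = (\<Sum>i\<in>S. bieval (f i) x y)"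
  by (simp add: bieval_def poly_sum)

lemma bieval_prod: "bieval (\<Prod>i\<in>S. f i) x y = (\<Prod>i\<in>S. bieval (f i) x y)"
  by (simp add: bieval_def poly_prod)

lemma bieval_bimon:
  "bieval (bimon c i j k l) x y = c * fst x ^ i * snd x ^ j * fst y ^ k * snd y ^ l"
  by (simp add: bieval_def bimon_def poly_monom)

lemma bieval_scale:
  assumes "f \<in> bihom d e"
  shows "bieval f (c * fst x, c * snd x) (c' * fst y, c' * snd y) = c ^ d * c' ^ e * bieval f x y"
proof -
  have "bieval (component d e f) (c * fst x, c * snd x) (c' * fst y, c' * snd y) =
      c ^ d * c' ^ e * bieval (component d e f) x y"
    unfolding component_def bieval_sum bieval_bimon sum_distrib_left
  proof (intro sum.cong refl)
    fix i k assume "i \<in> {..d}" "k \<in> {..e}"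
    then have "c ^ d = c ^ i * c ^ (d - i)" "c' ^ e = c' ^ k * c' ^ (e - k)"
      by (simp_all add: power_add[symmetric])
    then show "bicoeff f i (d - i) k (e - k) * fst (c * fst x, c * snd x) ^ i *
        snd (c * fst x, c * snd x) ^ (d - i) * fst (c' * fst y, c' * snd y) ^ k *
        snd (c' * fst y, c' * snd y) ^ (e - k) =
      c ^ d * c' ^ e * (bicoeff f i (d - i) k (e - k) * fst x ^ i * snd x ^ (d - i) *
        fst y ^ k * snd y ^ (e - k))"
      by (simp add: power_mult_distrib mult_ac)
  qed
  then show ?thesis using assms by (simp add: component_of_bihom)
qed

text \<open>The linear forms that vanish at the given point of the first, respectively second, factor.\<close>

definition form1 :: "complex \<times> complex \<Rightarrow> bipoly" where
  "form1 x = bimon (snd x) 1 0 0 0 - bimon (fst x) 0 1 0 0"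

definition form2 :: "complex \<times> complex \<Rightarrow> bipoly" where
  "form2 y = bimon (snd y) 0 0 1 0 - bimon (fst y) 0 0 0 1"

lemma form_bihom: "form1 x \<in> bihom 1 0" "form2 y \<in> bihom 0 1"
  using bihom_bimon[of _ 1 0 0 0] bihom_bimon[of _ 0 1 0 0] bihom_bimon[of _ 0 0 1 0]
    bihom_bimon[of _ 0 0 0 1]
  unfolding form1_def form2_def by (auto intro!: bihom_minus)

lemma bieval_form:
  "bieval (form1 x) z w = snd x * fst z - fst x * snd z"
  "bieval (form2 y) z w = snd y * fst w - fst y * snd w"
  by (simp_all add: form1_def form2_def bieval_simps bieval_bimon)

text \<open>Since \<open>form2 y\<close> involves only t and v, its divisor \<open>P\<close> has
  degree 0 in s and u. Then \<open>P\<close> divides the coefficients of s and u in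
  \<open>form1 x\<close>, which are up to sign the coordinates of \<open>x\<close>, and one of these
  is a nonzero constant.\<close>

lemma common_divisor_forms_unit:
  assumes x: "x \<noteq> (0, 0)" and y: "y \<noteq> (0, 0)" and P: "P dvd form1 x" "P dvd form2 y"
  shows "P dvd 1"
proof -
  define q :: "complex poly poly" where "q = monom (monom (snd y) 0) 1 - monom (monom (fst y) 1) 0"
  have form2: "form2 y = [:[:q:]:]"
    by (simp add: form2_def bimon_def q_def monom_0)
  have "q \<noteq> 0"
  proof
    assume "q = 0"
    then have "coeff (coeff q 1) 0 = 0" "coeff (coeff q 0) 1 = 0" by simp_all
    then show False using y by (simp add: q_def prod_eq_iff)
  qed
  obtain Q where Q: "[:[:q:]:] = P * Q" using P(2) form2 by (auto simp: dvd_def)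
  have nz: "P \<noteq> 0" "Q \<noteq> 0" using Q \<open>q \<noteq> 0\<close> by auto
  have "degree (P * Q) = 0" using Q by (metis degree_pCons_0)
  then have "degree P = 0" "degree Q = 0" using nz by (auto simp: degree_mult_eq)
  then obtain P1 Q1 where 1: "P = [:P1:]" "Q = [:Q1:]" by (metis degree_eq_zeroE)
  then have Q1: "[:q:] = P1 * Q1" using Q by simp
  have nz1: "P1 \<noteq> 0" "Q1 \<noteq> 0" using nz 1 by auto
  have "degree (P1 * Q1) = 0" using Q1 by (metis degree_pCons_0)
  then have "degree P1 = 0" using nz1 by (auto simp: degree_mult_eq)
  then obtain r where r: "P = [:[:r:]:]" using 1 by (metis degree_eq_zeroE)
  obtain T where T: "form1 x = P * T" using P(1) by (auto simp: dvd_def)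
  have "coeff (coeff (form1 x) i) j = r * coeff (coeff T i) j" for i j
    unfolding T r by simp
  then have "r dvd coeff (coeff (form1 x) i) j" for i j by simp
  from this[of 1 0] this[of 0 1] have "r dvd [:[:snd x:]:]" "r dvd [:[:- fst x:]:]"
    by (simp_all add: form1_def bimon_def monom_0)
  moreover have "[:[:snd x:]:] dvd 1 \<or> [:[:- fst x:]:] dvd 1"
    using x by (cases x) (auto simp: is_unit_const_poly_iff dvd_field_iff)
  ultimately have "r dvd 1" by (auto intro: dvd_trans)
  then show ?thesis unfolding r by (simp add: is_unit_const_poly_iff)
qed

text \<open>Evaluation is multiplicative and units do not vanish, so in a prime factorization of
  \<open>H\<close> one of the primes has to vanish.\<close>

lemma prime_divisor_vanishing:
  assumes "(H :: bipoly) \<noteq> 0" "bieval H x y = 0"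
  shows "\<exists>P. prime_elem P \<and> P dvd H \<and> bieval P x y = 0"
  using assms
proof (induction H rule: prime_divisors_induct)
  case zero
  then show ?case by simp
next
  case (unit H)
  then obtain H' where "1 = H * H'" by (auto simp: dvd_def)
  then have "bieval 1 x y = bieval H x y * bieval H' x y" by (metis bieval_simps(5))
  then show ?case using unit.prems by (simp add: bieval_simps)
next
  case (factor P H)
  show ?case
  proof (cases "bieval P x y = 0")
    case True
    then show ?thesis using factor.hyps by (intro exI[of _ P]) auto
  next
    case False
    then have "H \<noteq> 0" "bieval H x y = 0" using factor.prems by (auto simp: bieval_simps)
    then show ?thesis using factor.IH by (blast intro: dvd_mult)
  qed
qed


section \<open>The local ring at a point\<close>

text \<open>Fixing homogeneous coordinates \<open>x\<close>, \<open>y\<close> of \<open>p\<close>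
  reduces the vanishing of a bihomogeneous polynomial at \<open>p\<close> to one evaluation, by
  \<open>vanishes_iff\<close>.\<close>

locale proj_point =
  fixes p :: point and x y :: "complex \<times> complex"
  assumes x0: "x \<noteq> (0, 0)" and y0: "y \<noteq> (0, 0)"
    and fst_p: "fst p = proj_rel `` {x}" and snd_p: "snd p = proj_rel `` {y}"
begin

lemma vanishes_iff:
  assumes "f \<in> bihom d e"
  shows "vanishes_at f p \<longleftrightarrow> bieval f x y = 0"
proof
  have "x \<in> fst p" "y \<in> snd p"
    unfolding fst_p snd_p proj_rel_def using x0 y0 by (auto intro!: exI[of _ 1])
  then show "vanishes_at f p \<Longrightarrow> bieval f x y = 0" by (auto simp: vanishes_at_def)
  show "bieval f x y = 0 \<Longrightarrow> vanishes_at f p"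
    unfolding vanishes_at_def fst_p snd_p proj_rel_def by (auto simp: bieval_scale[OF assms])
qed

lemma stalk_eq:
  "stalk I p = {Fract f g | f g d e. f \<in> I \<and> f \<in> bihom d e \<and> g \<in> bihom d e \<and> bieval g x y \<noteq> 0}"
  unfolding stalk_def using vanishes_iff by blast

definition max_ideal :: "bipoly fract set" where
  "max_ideal = {Fract f g | f g d e. f \<in> bihom d e \<and> g \<in> bihom d e \<and> bieval f x y = 0 \<and> bieval g x y \<noteq> 0}"

lemma stalkE:
  assumes "a \<in> stalk I p"
  obtains f g d e where "a = Fract f g" "f \<in> I" "f \<in> bihom d e" "g \<in> bihom d e" "bieval g x y \<noteq> 0" "g \<noteq> 0"
  using assms unfolding stalk_eq by (force simp: bieval_simps)

lemma stalkI:
  "f \<in> I \<Longrightarrow> f \<in> bihom d e \<Longrightarrow> g \<in> bihom d e \<Longrightarrow> bieval g x y \<noteq> 0 \<Longrightarrow> Fract f g \<in> stalk I p"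
  unfolding stalk_eq by blast

lemma max_idealE:
  assumes "a \<in> max_ideal"
  obtains f g d e where "a = Fract f g" "f \<in> bihom d e" "g \<in> bihom d e"
    "bieval f x y = 0" "bieval g x y \<noteq> 0" "g \<noteq> 0"
  using assms unfolding max_ideal_def by (force simp: bieval_simps)

lemma max_idealI:
  "f \<in> bihom d e \<Longrightarrow> g \<in> bihom d e \<Longrightarrow> bieval f x y = 0 \<Longrightarrow> bieval g x y \<noteq> 0 \<Longrightarrow> Fract f g \<in> max_ideal"
  unfolding max_ideal_def by blast

text \<open>The definition of \<open>max_ideal\<close> asks for one suitable fraction;
  cross-multiplication carries the vanishing over to any other. This keeps 1 out of
  \<open>max_ideal\<close>.\<close>

lemma Fract_in_max_ideal_iff:
  assumes "g \<noteq> 0" "bieval g x y \<noteq> 0" "Fract f g \<in> max_ideal"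
  shows "bieval f x y = 0"
  using assms(3)
proof (rule max_idealE)
  fix f' g' assume *: "Fract f g = Fract f' g'" "bieval f' x y = 0" "bieval g' x y \<noteq> 0" "g' \<noteq> 0"
  then have "f * g' = f' * g" using assms by (simp add: eq_fract)
  then have "bieval f x y * bieval g' x y = bieval f' x y * bieval g x y"
    by (metis bieval_simps(5))
  then show ?thesis using * by simp
qed

sublocale local_subalgebra "stalk UNIV p" max_ideal "\<lambda>c. Fract (bconst c) 1"
proof
  fix a b assume a: "a \<in> stalk UNIV p" and b: "b \<in> stalk UNIV p"
  from a obtain f g d e where f: "a = Fract f g" "f \<in> bihom d e" "g \<in> bihom d e" "bieval g x y \<noteq> 0" "g \<noteq> 0"
    by (rule stalkE)
  from b obtain f' g' d' e' where f': "b = Fract f' g'" "f' \<in> bihom d' e'" "g' \<in> bihom d' e'"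
    "bieval g' x y \<noteq> 0" "g' \<noteq> 0" by (rule stalkE)
  have "f * g' + f' * g \<in> bihom (d + d') (e + e')"
    using bihom_add[OF bihom_mult[OF f(2) f'(3)]] bihom_mult[OF f'(2) f(3)] by (simp add: add.commute)
  then have "Fract (f * g' + f' * g) (g * g') \<in> stalk UNIV p"
    using f f' by (intro stalkI[of _ _ "d + d'" "e + e'"] bihom_mult) (auto simp: bieval_simps)
  then show "a + b \<in> stalk UNIV p" using f f' by simp
  have "Fract (f * f') (g * g') \<in> stalk UNIV p"
    using f f' by (intro stalkI[of _ _ "d + d'" "e + e'"] bihom_mult) (auto simp: bieval_simps)
  then show "a * b \<in> stalk UNIV p" using f f' by simp
next
  have "bconst c = bscale c 1" for c by (simp add: bscale_def)
  then have bc: "bconst c \<in> bihom 0 0" for c using bihom_bscale[OF bihom_1] by metis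
  show "Fract (bconst c) 1 \<in> stalk UNIV p" for c
    by (intro stalkI[of _ _ 0 0]) (auto simp: bieval_simps bc bihom_1)
  show "\<exists>c. a - Fract (bconst c) 1 \<in> max_ideal" if "a \<in> stalk UNIV p" for a
    using that
  proof (rule stalkE)
    fix f g d e
    assume f: "a = Fract f g" "f \<in> bihom d e" "g \<in> bihom d e" "bieval g x y \<noteq> 0" "g \<noteq> 0"
    \<comment> \<open>The residue class of a fraction is its value at the point.\<close>
    let ?c = "bieval f x y / bieval g x y"
    have "Fract (f - bscale ?c g) g \<in> max_ideal"
      using f by (intro max_idealI[of _ d e] bihom_minus bihom_bscale)
        (auto simp: bieval_simps bscale_def)
    then show "\<exists>c. a - Fract (bconst c) 1 \<in> max_ideal"
      using f by (intro exI[of _ ?c]) (simp add: bscale_def)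
  qed
next
  show "Fract (bconst 1) 1 = 1" by (simp add: bconst_simps One_fract_def)
  show "Fract (bconst (c + d)) 1 = Fract (bconst c) 1 + Fract (bconst d) 1"
    "Fract (bconst (c * d)) 1 = Fract (bconst c) 1 * Fract (bconst d) 1" for c d
    by (simp_all add: bconst_simps)
  show "max_ideal \<subseteq> stalk UNIV p" unfolding max_ideal_def stalk_eq by blast
  show "1 \<notin> max_ideal"
    using Fract_in_max_ideal_iff[of 1 1] by (auto simp: One_fract_def bieval_simps)
next
  fix a b assume a: "a \<in> max_ideal" and b: "b \<in> max_ideal"
  from a obtain f g d e where f: "a = Fract f g" "f \<in> bihom d e" "g \<in> bihom d e"
    "bieval f x y = 0" "bieval g x y \<noteq> 0" "g \<noteq> 0"
    by (rule max_idealE)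
  from b obtain f' g' d' e' where f': "b = Fract f' g'" "f' \<in> bihom d' e'" "g' \<in> bihom d' e'"
    "bieval f' x y = 0" "bieval g' x y \<noteq> 0" "g' \<noteq> 0" by (rule max_idealE)
  have "f * g' + f' * g \<in> bihom (d + d') (e + e')"
    using bihom_add[OF bihom_mult[OF f(2) f'(3)]] bihom_mult[OF f'(2) f(3)] by (simp add: add.commute)
  then have "Fract (f * g' + f' * g) (g * g') \<in> max_ideal"
    using f f' by (intro max_idealI[of _ "d + d'" "e + e'"] bihom_mult) (auto simp: bieval_simps)
  then show "a + b \<in> max_ideal" using f f' by simp
next
  fix a b assume a: "a \<in> stalk UNIV p" and b: "b \<in> max_ideal"
  from a obtain f g d e where f: "a = Fract f g" "f \<in> bihom d e" "g \<in> bihom d e" "bieval g x y \<noteq> 0" "g \<noteq> 0"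
    by (rule stalkE)
  from b obtain f' g' d' e' where f': "b = Fract f' g'" "f' \<in> bihom d' e'" "g' \<in> bihom d' e'"
    "bieval f' x y = 0" "bieval g' x y \<noteq> 0" "g' \<noteq> 0" by (rule max_idealE)
  have "Fract (f * f') (g * g') \<in> max_ideal"
    using f f' by (intro max_idealI[of _ "d + d'" "e + e'"] bihom_mult) (auto simp: bieval_simps)
  then show "a * b \<in> max_ideal" using f f' by simp
next
  fix a assume a: "a \<in> stalk UNIV p" "a \<notin> max_ideal"
  from a(1) obtain f g d e where f: "a = Fract f g" "f \<in> bihom d e" "g \<in> bihom d e" "bieval g x y \<noteq> 0" "g \<noteq> 0"
    by (rule stalkE)
  then have "bieval f x y \<noteq> 0" using a(2) max_idealI by blast
  then have "Fract g f \<in> stalk UNIV p" using f by (intro stalkI) auto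
  then show "inverse a \<in> stalk UNIV p" using f by simp
qed

lemma local_ring_eq: "local_ring p = ring_of"
  by (simp add: local_ring_def ring_of_def)

lemma local_parameters:
  obtains l1 l2 where "l1 \<in> bihom 1 0" "bieval l1 x y \<noteq> 0" "l2 \<in> bihom 0 1" "bieval l2 x y \<noteq> 0"
    "Fract (form1 x) l1 \<in> max_ideal" "Fract (form2 y) l2 \<in> max_ideal"
proof -
  \<comment> \<open>The forms of (0, 1) and (1, 0) are the coordinate functions up to sign, and not
    both coordinates of \<open>x\<close> are zero.\<close>
  have "\<exists>z. bieval (form1 z) x y \<noteq> 0"
    using x0 bieval_form(1)[of "(0, 1)" x y] bieval_form(1)[of "(1, 0)" x y] by (cases x) force
  moreover have "\<exists>z. bieval (form2 z) x y \<noteq> 0"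
    using y0 bieval_form(2)[of "(0, 1)" x y] bieval_form(2)[of "(1, 0)" x y] by (cases y) force
  ultimately obtain z w where zw: "bieval (form1 z) x y \<noteq> 0" "bieval (form2 w) x y \<noteq> 0" by blast
  have "Fract (form1 x) (form1 z) \<in> max_ideal" "Fract (form2 y) (form2 w) \<in> max_ideal"
    using zw by (auto intro!: max_idealI form_bihom simp: bieval_form mult.commute)
  then show ?thesis using that zw form_bihom by blast
qed

text \<open>If the numerators \<open>F\<close>, \<open>F'\<close> had a common factor vanishing at \<open>p\<close>, then a prime divisor
  of it would divide powers of both local parameters, since these lie in an ideal of finite
  colength; but the parameters are coprime.\<close>

lemma gcd_nonvanishing:
  assumes F: "G \<noteq> 0" "bieval G x y \<noteq> 0" and F': "G' \<noteq> 0" "bieval G' x y \<noteq> 0"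
    and fg: "Fract F G \<in> stalk UNIV p" "Fract F' G' \<in> stalk UNIV p"
    and d: "quot_dim smult (stalk UNIV p) (Idl\<^bsub>ring_of\<^esub> {Fract F G, Fract F' G'}) = enat d"
  shows "bieval (gcd F F') x y \<noteq> 0"
proof
  define H where "H = gcd F F'"
  assume "bieval (gcd F F') x y = 0"
  then have H0: "bieval H x y = 0" by (simp add: H_def)
  let ?J = "Idl\<^bsub>ring_of\<^esub> {Fract F G, Fract F' G'}"
  interpret ring ring_of by (rule ring_ring_of)
  have J: "is_ideal ?J" using genideal_ideal[of "{Fract F G, Fract F' G'}"] fg by (simp add: ideal_iff)
  \<comment> \<open>After denominators are cleared, the factor \<open>H\<close> survives in the
    numerator of every element of the ideal.\<close>
  have J_dvd: "\<exists>W U. a = Fract (H * W) U \<and> bieval U x y \<noteq> 0 \<and> U \<noteq> 0" if aJ: "a \<in> ?J" for a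
  proof -
    obtain b c where a: "a = Fract F G * b + c * Fract F' G'" and bc: "b \<in> stalk UNIV p" "c \<in> stalk UNIV p"
      using aJ unfolding genideal_two[OF fg] by blast
    from bc(1) obtain b1 b2 where b: "b = Fract b1 b2" "bieval b2 x y \<noteq> 0" "b2 \<noteq> 0" by (rule stalkE)
    from bc(2) obtain c1 c2 where c: "c = Fract c1 c2" "bieval c2 x y \<noteq> 0" "c2 \<noteq> 0" by (rule stalkE)
    obtain F1 F1' where F1: "F = H * F1" "F' = H * F1'" unfolding H_def by (metis dvdE gcd_dvd1 gcd_dvd2)
    have "a = Fract (F * b1 * (c2 * G') + c1 * F' * (G * b2)) (G * b2 * (c2 * G'))"
      using a b c F(1) F'(1) by simp
    also have "F * b1 * (c2 * G') + c1 * F' * (G * b2) = H * (F1 * b1 * (c2 * G') + c1 * F1' * (G * b2))"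
      by (simp add: F1 algebra_simps)
    finally have "a = Fract (H * (F1 * b1 * (c2 * G') + c1 * F1' * (G * b2))) (G * b2 * (c2 * G'))" .
    moreover have "bieval (G * b2 * (c2 * G')) x y \<noteq> 0" "G * b2 * (c2 * G') \<noteq> 0"
      using b c F F' by (simp_all add: bieval_simps)
    ultimately show ?thesis by blast
  qed
  have key: "\<exists>N U W. form ^ N * U = H * W \<and> bieval U x y \<noteq> 0 \<and> U \<noteq> 0"
    if z: "Fract form l \<in> max_ideal" and l: "bieval l x y \<noteq> 0" for form l
  proof -
    obtain N where N: "Fract form l ^ N \<in> ?J" using nilpotent_mod_ideal[OF J d z] by blast
    have pow: "Fract form l ^ N = Fract (form ^ N) (l ^ N)"
      by (induction N) (simp_all add: One_fract_def)
    obtain W U where WU: "Fract form l ^ N = Fract (H * W) U" "bieval U x y \<noteq> 0" "U \<noteq> 0"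
      using J_dvd[OF N] by blast
    have "l \<noteq> 0" using l by (auto simp: bieval_simps)
    then have "form ^ N * U = H * (W * l ^ N)" using WU pow by (simp add: eq_fract mult.assoc)
    then show ?thesis using WU by blast
  qed
  obtain l1 l2 where l: "bieval l1 x y \<noteq> 0" "bieval l2 x y \<noteq> 0"
    "Fract (form1 x) l1 \<in> max_ideal" "Fract (form2 y) l2 \<in> max_ideal" by (rule local_parameters)
  obtain N U W where 1: "form1 x ^ N * U = H * W" "bieval U x y \<noteq> 0" "U \<noteq> 0" using key[OF l(3,1)] by blast
  obtain N' U' W' where 2: "form2 y ^ N' * U' = H * W'" "bieval U' x y \<noteq> 0" using key[OF l(4,2)] by blast
  \<comment> \<open>As \<open>form1 x\<close> and \<open>U\<close> are nonzero, so is
    \<open>H\<close>, which \<open>prime_divisor_vanishing\<close> requires.\<close>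
  have "\<exists>z. bieval (form1 x) z y \<noteq> 0"
    using x0 bieval_form(1)[of x "(0, 1)" y] bieval_form(1)[of x "(1, 0)" y] by (cases x) force
  then have "form1 x \<noteq> 0" by (auto simp: bieval_simps)
  then have "H \<noteq> 0" using 1 by auto
  then obtain P where P: "prime_elem P" "P dvd H" "bieval P x y = 0"
    using prime_divisor_vanishing[OF _ H0] by blast
  \<comment> \<open>Since \<open>P\<close> vanishes at the point, it cannot divide \<open>U\<close>
    or \<open>U'\<close>; being prime, it must divide the linear forms.\<close>
  have nU: "\<not> P dvd U" if "bieval U x y \<noteq> 0" for U
    using that P(3) by (auto simp: dvd_def bieval_simps)
  have "P dvd form1 x ^ N * U" "P dvd form2 y ^ N' * U'" unfolding 1 2 using P(2) by simp_all
  then have "P dvd form1 x" "P dvd form2 y"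
    using P(1) nU 1(2) 2(2) by (auto simp: prime_elem_dvd_mult_iff dest: prime_elem_dvd_power)
  then have "P dvd 1" by (rule common_divisor_forms_unit[OF x0 y0])
  then show False using P(1) by (simp add: prime_elem_def)
qed

text \<open>Divided by their gcd \<open>H\<close>, which does not vanish at \<open>p\<close>, the
  numerators of \<open>f\<close> and \<open>g\<close> become coprime, and this gives divisibility by
  the numerator of \<open>f\<close> up to \<open>H\<close>. It remains to turn \<open>H\<close> and
  the quotient \<open>W\<close> into bihomogeneous polynomials, since the local ring consists of
  fractions of such.\<close>

lemma regular_sequence:
  assumes f: "f \<in> stalk UNIV p" and g: "g \<in> max_ideal"
    and d: "quot_dim smult (stalk UNIV p) (Idl\<^bsub>ring_of\<^esub> {f, g}) = enat d"
  shows "f \<noteq> 0"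
    and "\<And>c. c \<in> stalk UNIV p \<Longrightarrow> g * c \<in> (*) f ` stalk UNIV p \<Longrightarrow> c \<in> (*) f ` stalk UNIV p"
proof -
  from f obtain F G i j where F: "f = Fract F G" "F \<in> bihom i j" "G \<in> bihom i j" "bieval G x y \<noteq> 0" "G \<noteq> 0"
    by (rule stalkE)
  from g obtain F' G' where F': "g = Fract F' G'" "bieval F' x y = 0" "bieval G' x y \<noteq> 0" "G' \<noteq> 0"
    by (rule max_idealE)
  define H where "H = gcd F F'"
  have gA: "g \<in> stalk UNIV p" using g M_A by blast
  have H: "bieval H x y \<noteq> 0"
    unfolding H_def using gcd_nonvanishing[of G G' F F' d] F F' f gA d by simp
  then have H0: "H \<noteq> 0" by (auto simp: bieval_simps)
  show "f \<noteq> 0"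
  proof
    assume "f = 0"
    \<comment> \<open>For \<open>F = 0\<close> the gcd would be a multiple of \<open>F'\<close>,
      which vanishes at the point.\<close>
    then have "F = 0" using F by (simp add: Zero_fract_def eq_fract)
    then have "F' dvd H" by (simp add: H_def)
    then show False using H F'(2) by (auto simp: dvd_def bieval_simps)
  qed
  fix c assume c: "c \<in> stalk UNIV p" and "g * c \<in> (*) f ` stalk UNIV p"
  then obtain e where e: "e \<in> stalk UNIV p" "g * c = f * e" by blast
  from c obtain C1 C2 a b where C: "c = Fract C1 C2" "C1 \<in> bihom a b" "C2 \<in> bihom a b" "bieval C2 x y \<noteq> 0" "C2 \<noteq> 0"
    by (rule stalkE)
  from e(1) obtain D1 D2 k l where D: "e = Fract D1 D2" "D2 \<in> bihom k l" "bieval D2 x y \<noteq> 0" "D2 \<noteq> 0"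
    by (rule stalkE)
  define F1 where "F1 = F div H"
  define F1' where "F1' = F' div H"
  have F1: "F = H * F1" "F' = H * F1'" by (simp_all add: F1_def F1'_def H_def)
  have "coprime F1 F1'" unfolding F1_def F1'_def H_def
    using H0 by (intro div_gcd_coprime) (auto simp: H_def)
  have "F' * C1 * (G * D2) = F * D1 * (G' * C2)"
    using e(2) C D F F' by (simp add: eq_fract)
  then have "H * (F1' * (C1 * G * D2)) = H * (F1 * (D1 * G' * C2))"
    unfolding F1 by (simp add: mult_ac)
  then have "F1' * (C1 * G * D2) = F1 * (D1 * G' * C2)" using H0 by simp
  then have "F1 dvd F1' * (C1 * G * D2)" by simp
  then have "F1 dvd C1 * G * D2" using \<open>coprime F1 F1'\<close> by (simp add: coprime_dvd_mult_right_iff)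
  then obtain W where W: "C1 * G * D2 = F1 * W" by (auto simp: dvd_def)
  \<comment> \<open>Since \<open>H\<close> does not vanish at the point, neither do all of its
    bihomogeneous components.\<close>
  obtain n where n: "H = (\<Sum>a\<le>n. \<Sum>b\<le>n. component a b H)" using sum_components[of H] by blast
  have "\<exists>r s. bieval (component r s H) x y \<noteq> 0"
  proof (rule ccontr)
    assume "\<not> ?thesis"
    then have "bieval (\<Sum>a\<le>n. \<Sum>b\<le>n. component a b H) x y = 0" by (simp add: bieval_sum)
    then show False using H n by simp
  qed
  then obtain r s where rs: "bieval (component r s H) x y \<noteq> 0" by blast
  let ?H = "component r s H"
  let ?W = "component (a + k + r) (b + l + s) W"
  \<comment> \<open>Taking the component in which \<open>H\<close> contributes \<open>?H\<close>
    makes every factor of this identity bihomogeneous, and \<open>?H\<close> may still serve in a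
    denominator.\<close>
  have "C1 * G * D2 * H = F * W" unfolding F1 W by (simp add: mult_ac)
  moreover have "component ((a + i + k) + r) ((b + j + l) + s) (C1 * G * D2 * H) = C1 * G * D2 * ?H"
    by (intro component_mult bihom_mult C F D)
  moreover have "component (i + (a + k + r)) (j + (b + l + s)) (F * W) = F * ?W"
    by (intro component_mult F)
  ultimately have eq: "C1 * G * D2 * ?H = F * ?W" by (simp add: ac_simps)
  have "?H \<noteq> 0" using rs by (auto simp: bieval_simps)
  then have "c = f * Fract ?W (C2 * D2 * ?H)"
    using C F D eq by (simp add: eq_fract mult_ac)
  moreover have "Fract ?W (C2 * D2 * ?H) \<in> stalk UNIV p"
    using C D rs by (intro stalkI[of _ _ "a + k + r" "b + l + s"] component_bihom bihom_mult)
      (auto simp: bieval_simps)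
  ultimately show "c \<in> (*) f ` stalk UNIV p" by blast
qed

text \<open>The inclusion in \<open>max_ideal\<close> holds at base points; it puts the generator
  \<open>g\<close> into the maximal ideal, as \<open>regular_sequence\<close> demands.\<close>

lemma hs_mult_eq_colength:
  assumes lci: "lci_at I p" and I: "stalk I p \<subseteq> max_ideal"
    and d: "quot_dim smult (stalk UNIV p) (stalk I p) = enat d"
  shows "hs_mult I p = real d"
proof -
  obtain f g where fg: "f \<in> stalk UNIV p" "g \<in> stalk UNIV p" "stalk I p = Idl\<^bsub>ring_of\<^esub> {f, g}"
    using lci unfolding lci_at_def local_ring_eq by auto
  have "g \<in> stalk I p" unfolding fg(3) genideal_def by auto
  then have g: "g \<in> max_ideal" using I by blast
  note d' = d[unfolded fg(3)]
  show ?thesis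
    unfolding hs_mult_def local_ring_eq fg(3)
    by (rule multiplicity_regular_sequence[OF fg(1,2) regular_sequence[OF fg(1) g d'] d'])
qed

end


section \<open>The degree of a finite scheme\<close>

lemma P1_rep:
  assumes "q \<in> P1" obtains x where "x \<noteq> (0, 0)" "q = proj_rel `` {x}"
  using assms unfolding P1_def by (auto elim!: quotientE)

lemma point_rep:
  assumes "p \<in> P1 \<times> P1" obtains x y where "proj_point p x y"
proof -
  have "fst p \<in> P1" "snd p \<in> P1" using assms by auto
  then obtain x y where "x \<noteq> (0, 0)" "fst p = proj_rel `` {x}" "y \<noteq> (0, 0)" "snd p = proj_rel `` {y}"
    by (metis P1_rep)
  then show ?thesis using that by (simp add: proj_point_def)
qed

lemma proj_class_eq:
  assumes x: "x \<noteq> (0, 0)" and z: "z \<noteq> (0, 0)" and eq: "snd x * fst z = fst x * snd z"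
  shows "proj_rel `` {x} = proj_rel `` {z}"
proof -
  have sub: "proj_rel `` {z} \<subseteq> proj_rel `` {x}"
    if "z \<noteq> (0, 0)" "x \<noteq> (0, 0)" and eq: "snd x * fst z = fst x * snd z" for x z
  proof -
    have "\<exists>c. fst z = c * fst x \<and> snd z = c * snd x"
    proof (cases "fst x = 0")
      case True
      then have "snd x \<noteq> 0" using that(2) by (cases x) auto
      then show ?thesis using True eq by (intro exI[of _ "snd z / snd x"]) auto
    next
      case False
      then show ?thesis using eq by (intro exI[of _ "fst z / fst x"]) (auto simp: field_simps)
    qed
    then obtain c where "fst z = c * fst x" "snd z = c * snd x" by blast
    then show ?thesis using that by (auto simp: proj_rel_def intro!: exI[of _ "_ * c"])
  qed
  show ?thesis using sub[OF z x eq] sub[OF x z] eq by (auto simp: mult.commute)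
qed

text \<open>Different points differ in one of the two factors, and there the linear form belonging
  to \<open>q\<close> does not vanish at \<open>p\<close>.\<close>

lemma separating_form:
  assumes p: "p \<in> P1 \<times> P1" and q: "q \<in> P1 \<times> P1" and ne: "p \<noteq> q"
  shows "\<exists>d e. \<exists>f \<in> bihom d e. vanishes_at f q \<and> \<not> vanishes_at f p"
proof -
  obtain x y where xy: "proj_point p x y" using point_rep[OF p] .
  obtain z w where zw: "proj_point q z w" using point_rep[OF q] .
  interpret p: proj_point p x y by (rule xy)
  interpret q: proj_point q z w by (rule zw)
  have "snd z * fst x \<noteq> fst z * snd x \<or> snd w * fst y \<noteq> fst w * snd y"
  proof (rule ccontr)
    assume "\<not> ?thesis"
    then have "fst p = fst q" "snd p = snd q"
      unfolding p.fst_p p.snd_p q.fst_p q.snd_p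
      using proj_class_eq[OF q.x0 p.x0] proj_class_eq[OF q.y0 p.y0] by auto
    then show False using ne by (simp add: prod_eq_iff)
  qed
  then show ?thesis
  proof
    assume "snd z * fst x \<noteq> fst z * snd x"
    then have "vanishes_at (form1 z) q" "\<not> vanishes_at (form1 z) p"
      by (simp_all add: q.vanishes_iff[OF form_bihom(1)] p.vanishes_iff[OF form_bihom(1)] bieval_form mult.commute)
    then show ?thesis using form_bihom(1) by blast
  next
    assume "snd w * fst y \<noteq> fst w * snd y"
    then have "vanishes_at (form2 w) q" "\<not> vanishes_at (form2 w) p"
      by (simp_all add: q.vanishes_iff[OF form_bihom(2)] p.vanishes_iff[OF form_bihom(2)] bieval_form mult.commute)
    then show ?thesis using form_bihom(2) by blast
  qed
qed

lemma separating_form_finite: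
  assumes p: "p \<in> P1 \<times> P1" and S: "finite S" "S \<subseteq> P1 \<times> P1" "p \<notin> S"
  shows "\<exists>d e. \<exists>f \<in> bihom d e. (\<forall>q\<in>S. vanishes_at f q) \<and> \<not> vanishes_at f p"
proof -
  have "\<forall>q\<in>S. \<exists>f. (\<exists>d e. f \<in> bihom d e) \<and> vanishes_at f q \<and> \<not> vanishes_at f p"
    using separating_form[OF p] S by (metis subsetD)
  from bchoice[OF this] obtain f where f: "\<And>q. q \<in> S \<Longrightarrow> (\<exists>d e. f q \<in> bihom d e)"
    "\<And>q. q \<in> S \<Longrightarrow> vanishes_at (f q) q" "\<And>q. q \<in> S \<Longrightarrow> \<not> vanishes_at (f q) p" by blast
  obtain d e where de: "(\<Prod>q\<in>S. f q) \<in> bihom d e" using bihom_prod[of S f] S(1) f(1) by blast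
  have "vanishes_at (\<Prod>q\<in>S. f q) q" if q: "q \<in> S" for q
    unfolding vanishes_at_def bieval_prod
    using f(2)[OF q] q S(1) by (auto simp: vanishes_at_def)
  moreover have "\<not> vanishes_at (\<Prod>q\<in>S. f q) p"
  proof -
    obtain x y where xy: "proj_point p x y" using point_rep[OF p] .
    interpret proj_point p x y by (rule xy)
    have "bieval (f q) x y \<noteq> 0" if "q \<in> S" for q
      using f(1,3)[OF that] vanishes_iff by blast
    then show ?thesis using S(1) by (simp add: vanishes_iff[OF de] bieval_prod)
  qed
  ultimately show ?thesis using de by blast
qed

text \<open>Coincides with \<open>smult\<close> of the local ring at each point, so that the
  colengths at different points are measured by the same scalar multiplication.\<close>

abbreviation fscale :: "complex \<Rightarrow> bipoly fract \<Rightarrow> bipoly fract" where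
  "fscale c a \<equiv> Fract (bconst c) 1 * a"

text \<open>A finite scheme is discrete: each base point has a neighbourhood without other base
  points, so any choice of local elements is a section.\<close>

lemma lift_sections_eq:
  assumes fin: "finite (base_points I)" and I: "0 \<in> I"
  shows "lift_sections I = {\<sigma>. \<forall>p\<in>base_points I. \<sigma> p \<in> stalk UNIV p}"
proof (rule antisym; rule subsetI)
  fix \<sigma> assume "\<sigma> \<in> lift_sections I"
  then show "\<sigma> \<in> {\<sigma>. \<forall>p\<in>base_points I. \<sigma> p \<in> stalk UNIV p}"
    by (auto simp: lift_sections_def local_ring_def)
next
  fix \<sigma> assume \<sigma>: "\<sigma> \<in> {\<sigma>. \<forall>p\<in>base_points I. \<sigma> p \<in> stalk UNIV p}"
  have sub: "base_points I \<subseteq> P1 \<times> P1" by (auto simp: base_points_def)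
  have "\<exists>d e. \<exists>f\<in>bihom d e. \<exists>g\<in>bihom d e. \<not> vanishes_at g p \<and>
      (\<forall>q\<in>base_points I. \<not> vanishes_at g q \<longrightarrow> \<sigma> q - Fract f g \<in> stalk I q)"
    if p: "p \<in> base_points I" for p
  proof -
    obtain x y where xy: "proj_point p x y" using point_rep[of p] p sub by blast
    interpret proj_point p x y by (rule xy)
    \<comment> \<open>Expanding the fraction by \<open>h\<close> shrinks the neighbourhood: where
      \<open>h * g\<close> does not vanish, \<open>p\<close> is the only base point.\<close>
    obtain d e h where h: "h \<in> bihom d e" "\<forall>q\<in>base_points I - {p}. vanishes_at h q" "\<not> vanishes_at h p"
      using separating_form_finite[of p "base_points I - {p}"] p sub fin by blast
    have "\<sigma> p \<in> stalk UNIV p" using \<sigma> p by blast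
    then obtain f g d' e' where f: "\<sigma> p = Fract f g" "f \<in> bihom d' e'" "g \<in> bihom d' e'"
      "bieval g x y \<noteq> 0" "g \<noteq> 0" by (rule stalkE)
    have hp: "bieval h x y \<noteq> 0" using h(3) vanishes_iff[OF h(1)] by simp
    have "\<sigma> q - Fract (h * f) (h * g) \<in> stalk I q"
      if q: "q \<in> base_points I" "\<not> vanishes_at (h * g) q" for q
    proof -
      have "\<not> vanishes_at h q" using q(2) by (auto simp: vanishes_at_def bieval_simps)
      then have "q = p" using h(2) q(1) by blast
      moreover have "h \<noteq> 0" using hp by (auto simp: bieval_simps)
      ultimately have "\<sigma> q - Fract (h * f) (h * g) = Fract 0 1" using f by (simp add: eq_fract Zero_fract_def)
      also have "\<dots> \<in> stalk I p"
        using I by (intro stalkI[of _ _ 0 0]) (auto simp: bihom_1 bieval_simps)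
      finally show ?thesis using \<open>q = p\<close> by simp
    qed
    moreover have "\<not> vanishes_at (h * g) p"
      using vanishes_iff[OF bihom_mult[OF h(1) f(3)]] hp f by (simp add: bieval_simps)
    ultimately show ?thesis using bihom_mult[OF h(1)] f(2,3) by blast
  qed
  then show "\<sigma> \<in> lift_sections I"
    using \<sigma> unfolding lift_sections_def local_ring_def by auto
qed

text \<open>The sections are independent choices at the base points, and \<open>lift_zero I\<close>
  is the joint kernel of the evaluations modulo the stalks.\<close>

lemma scheme_degree_eq_sum:
  assumes fin: "finite (base_points I)" and I: "0 \<in> I"
    and sub: "\<And>p. p \<in> base_points I \<Longrightarrow> module.subspace fscale (stalk I p)"
  shows "scheme_degree I = (\<Sum>p\<in>base_points I. quot_dim fscale (stalk UNIV p) (stalk I p))"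
proof -
  let ?s = "\<lambda>c (\<sigma> :: point \<Rightarrow> bipoly fract) p. fscale c (\<sigma> p)"
  have vsf: "vector_space fscale"
  proof -
    have "Fract (bconst (c + d)) 1 = Fract (bconst c) 1 + Fract (bconst d) 1"
      "Fract (bconst (c * d)) 1 = Fract (bconst c) 1 * Fract (bconst d) 1"
      "Fract (bconst 1) 1 = 1" for c d
      by (simp_all add: bconst_simps One_fract_def)
    then show ?thesis by unfold_locales (simp_all add: algebra_simps del: mult_fract add_fract)
  qed
  have vss: "vector_space ?s"
  proof -
    interpret vector_space fscale by (rule vsf)
    show ?thesis
      by unfold_locales (simp_all only: fun_eq_iff plus_fun_apply scale_right_distrib scale_left_distrib scale_scale scale_one simp_thms)
  qed
  have A: "module.subspace fscale (stalk UNIV p)" if p: "p \<in> base_points I" for p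
  proof -
    have "p \<in> P1 \<times> P1" using p by (auto simp: base_points_def)
    then obtain x y where xy: "proj_point p x y" by (rule point_rep)
    interpret proj_point p x y by (rule xy)
    show ?thesis by (rule is_ideal_subspace[OF is_ideal_A])
  qed
  have "quot_dim ?s (lift_sections I) {\<sigma> \<in> lift_sections I. \<forall>p\<in>base_points I. \<sigma> p \<in> stalk I p} =
      (\<Sum>p\<in>base_points I. quot_dim fscale (stalk UNIV p) (stalk I p))"
  proof (rule quot_dim_joint_kernel[where \<phi> = "\<lambda>p \<sigma>. \<sigma> p", OF _ fin _ vss])
    show "Vector_Spaces.linear ?s fscale (\<lambda>\<sigma>. \<sigma> p)" for p
      unfolding Vector_Spaces.linear_iff using vss vsf by simp
    interpret s: vector_space ?s by (rule vss)
    interpret f: vector_space fscale by (rule vsf)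
    show "s.subspace (lift_sections I)"
      unfolding lift_sections_eq[OF fin I] using A
      by (intro s.subspaceI) (auto simp: f.subspace_0 f.subspace_add f.subspace_scale)
    show "\<sigma> p \<in> stalk UNIV p" if "p \<in> base_points I" "\<sigma> \<in> lift_sections I" for p \<sigma>
      using that unfolding lift_sections_eq[OF fin I] by blast
    \<comment> \<open>Any local element at \<open>p\<close>, continued by 0, is a section.\<close>
    show "\<exists>\<sigma>\<in>lift_sections I. a - \<sigma> p \<in> stalk I p \<and> (\<forall>q\<in>base_points I - {p}. \<sigma> q \<in> stalk I q)"
      if p: "p \<in> base_points I" and a: "a \<in> stalk UNIV p" for p a
      unfolding lift_sections_eq[OF fin I] using a p A sub
      by (intro bexI[of _ "\<lambda>q. if q = p then a else 0"]) (auto simp: f.subspace_0)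
  qed (rule sub)
  moreover have "quot_dim ?s (lift_sections I) {\<sigma> \<in> lift_sections I. \<forall>p\<in>base_points I. \<sigma> p \<in> stalk I p} =
      quot_dim ?s (lift_sections I) (lift_zero I)"
  proof -
    have "stalk I p \<subseteq> stalk UNIV p" for p unfolding stalk_def by blast
    then have "{\<sigma> \<in> lift_sections I. \<forall>p\<in>base_points I. \<sigma> p \<in> stalk I p} = lift_zero I"
      unfolding lift_sections_eq[OF fin I] lift_zero_def by blast
    then show ?thesis by simp
  qed
  ultimately show ?thesis unfolding scheme_degree_def by simp
qed


section \<open>Syzygies and the cokernel\<close>

lemma quot_dim_complex: "quot_dim (*) (UNIV :: complex set) {0} = 1"
proof -
  interpret complex_vector_space "(*) :: complex \<Rightarrow> complex \<Rightarrow> complex"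
    by unfold_locales (simp_all add: algebra_simps)
  show ?thesis
  proof (rule antisym)
    show "1 \<le> quot_dim (*) (UNIV :: complex set) {0}"
      by (rule quot_dim_pos[of _ 1]) auto
    have "quot_dim (*) (UNIV :: complex set) {0} \<le> enat (card {1 :: complex})"
      by (rule quot_dim_le_card) (auto intro: exI[of _ "\<lambda>_. v" for v])
    then show "quot_dim (*) (UNIV :: complex set) {0} \<le> 1" by (simp add: one_enat_def)
  qed
qed

lemma bihom_subspace: "module.subspace bscale (bihom d e)"
proof -
  interpret vector_space bscale by (rule vector_space_bscale)
  show ?thesis by (intro subspaceI bihom_0 bihom_add bihom_bscale)
qed

text \<open>The coefficients at the monomials of bidegree (d, e) are functionals that can be
  prescribed independently and have joint kernel 0.\<close>

lemma quot_dim_bihom: "quot_dim bscale (bihom d e) {0} = enat (Suc d * Suc e)"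
proof -
  let ?S = "{..d} \<times> {..e}"
  let ?\<phi> = "\<lambda>(i, k) f. bicoeff f i (d - i) k (e - k)"
  interpret c: vector_space "(*) :: complex \<Rightarrow> complex \<Rightarrow> complex"
    by unfold_locales (simp_all add: algebra_simps)
  have "{f \<in> bihom d e. \<forall>i\<in>?S. ?\<phi> i f \<in> {0}} = {0}"
  proof safe
    fix f assume f: "f \<in> bihom d e" "\<forall>i\<in>?S. ?\<phi> i f \<in> {0}"
    have "component d e f = 0" unfolding component_def
    proof (intro sum.neutral ballI)
      fix i k assume "i \<in> {..d}" "k \<in> {..e}"
      then have "bicoeff f i (d - i) k (e - k) = 0" using f(2) by auto
      then show "bimon (bicoeff f i (d - i) k (e - k)) i (d - i) k (e - k) = 0"
        by (simp add: bimon_def)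
    qed
    then show "f = 0" using f(1) by (simp add: component_of_bihom)
  qed auto
  moreover have "quot_dim bscale (bihom d e) {f \<in> bihom d e. \<forall>i\<in>?S. ?\<phi> i f \<in> {0}} =
      (\<Sum>i\<in>?S. quot_dim (*) (UNIV :: complex set) {0})"
  proof (rule quot_dim_joint_kernel)
    show "Vector_Spaces.linear bscale (*) (?\<phi> i)" for i
      unfolding Vector_Spaces.linear_iff using vector_space_bscale c.vector_space_axioms by (auto split: prod.split)
    show "\<exists>f\<in>bihom d e. y - ?\<phi> i f \<in> {0} \<and> (\<forall>j\<in>?S - {i}. ?\<phi> j f \<in> {0})"
      if "i \<in> ?S" for i y
    proof -
      obtain a b where i: "i = (a, b)" "a \<le> d" "b \<le> e" using \<open>i \<in> ?S\<close> by auto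
      have "bimon y a (d - a) b (e - b) \<in> bihom d e"
        using bihom_bimon[of y a "d - a" b "e - b"] i by simp
      then show ?thesis using i
        by (intro bexI[of _ "bimon y a (d - a) b (e - b)"]) (auto simp: bicoeff_bimon split: if_splits)
    qed
  qed (auto simp: vector_space_bscale bihom_subspace c.subspace_single_0)
  ultimately show ?thesis by (simp add: quot_dim_complex of_nat_eq_enat)
qed

lemma vector_space_bscale4: "vector_space bscale4"
proof -
  interpret vector_space bscale by (rule vector_space_bscale)
  show ?thesis
    by unfold_locales (auto simp: bscale4_def scale_right_distrib scale_left_distrib split: prod.split)
qed

definition bihom4 :: "nat \<Rightarrow> nat \<Rightarrow> (bipoly \<times> bipoly \<times> bipoly \<times> bipoly) set" where
  "bihom4 d e = bihom d e \<times> bihom d e \<times> bihom d e \<times> bihom d e"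

lemma bihom4_subspace: "module.subspace bscale4 (bihom4 d e)"
proof -
  interpret vector_space bscale4 by (rule vector_space_bscale4)
  show ?thesis
    by (intro subspaceI) (auto simp: bihom4_def bscale4_def zero_prod_def intro: bihom_add bihom_bscale)
qed

lemma quot_dim_bihom4: "quot_dim bscale4 (bihom4 d e) {0} = enat (4 * (Suc d * Suc e))"
proof -
  let ?\<phi> = "\<lambda>i (A0, A1, A2, A3). [A0, A1, A2, A3] ! i"
  let ?S = "{0, 1, 2, 3} :: nat set"
  interpret b: vector_space bscale by (rule vector_space_bscale)
  have "quot_dim bscale4 (bihom4 d e) {A \<in> bihom4 d e. \<forall>i\<in>?S. ?\<phi> i A \<in> {0}} =
      (\<Sum>i\<in>?S. quot_dim bscale (bihom d e) {0})"
  proof (rule quot_dim_joint_kernel)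
    show "Vector_Spaces.linear bscale4 bscale (?\<phi> i)" if "i \<in> ?S" for i
      unfolding Vector_Spaces.linear_iff using that vector_space_bscale vector_space_bscale4
      by (auto simp: bscale4_def)
    show "\<exists>A\<in>bihom4 d e. y - ?\<phi> i A \<in> {0} \<and> (\<forall>j\<in>?S - {i}. ?\<phi> j A \<in> {0})"
      if "i \<in> ?S" "y \<in> bihom d e" for i y
      using that
      by (intro bexI[of _ "(if i = 0 then y else 0, if i = 1 then y else 0,
        if i = 2 then y else 0, if i = 3 then y else 0)"]) (auto simp: bihom4_def)
  qed (use bihom4_subspace in \<open>auto simp: vector_space_bscale4 b.subspace_single_0 bihom4_def\<close>)
  moreover have "{A \<in> bihom4 d e. \<forall>i\<in>?S. ?\<phi> i A \<in> {0}} = {0}"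
    by (auto simp: bihom4_def zero_prod_def)
  moreover have "(\<Sum>i\<in>?S. quot_dim bscale (bihom d e) {0}) = enat (4 * (Suc d * Suc e))"
    by (simp only: quot_dim_bihom sum_constant of_nat_eq_enat times_enat_simps) simp
  ultimately show ?thesis by simp
qed

section \<open>Bihomogeneous parts of the ideal and the dimension count\<close>

lemma gen_ideal_iff:
  "f \<in> gen_ideal {a0, a1, a2, a3} \<longleftrightarrow> (\<exists>B0 B1 B2 B3. f = B0 * a0 + B1 * a1 + B2 * a2 + B3 * a3)"
proof -
  interpret module "(*) :: bipoly \<Rightarrow> _" by unfold_locales (simp_all add: algebra_simps)
  have "f \<in> gen_ideal {a0, a1, a2, a3} \<longleftrightarrow>
      (\<exists>B0 B1 B2 B3. f - B0 * a0 - B1 * a1 - B2 * a2 - B3 * a3 = 0)"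
    by (simp add: gen_ideal_def span_breakdown_eq)
  also have "\<dots> \<longleftrightarrow> (\<exists>B0 B1 B2 B3. f = B0 * a0 + B1 * a1 + B2 * a2 + B3 * a3)"
    by (simp add: algebra_simps)
  finally show ?thesis .
qed

text \<open>Because the generators are bihomogeneous, the cofactors of an element of bidegree (m +
  d, n + e) can be replaced by their components of bidegree (d, e).\<close>

lemma gen_ideal_bihom:
  assumes a: "a0 \<in> bihom m n" "a1 \<in> bihom m n" "a2 \<in> bihom m n" "a3 \<in> bihom m n"
  shows "gen_ideal {a0, a1, a2, a3} \<inter> bihom (m + d) (n + e) =
    (\<lambda>(A0, A1, A2, A3). A0 * a0 + A1 * a1 + A2 * a2 + A3 * a3) ` bihom4 d e"
proof (rule antisym; rule subsetI)
  fix f assume f: "f \<in> gen_ideal {a0, a1, a2, a3} \<inter> bihom (m + d) (n + e)"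
  then obtain B0 B1 B2 B3 where "f = B0 * a0 + B1 * a1 + B2 * a2 + B3 * a3"
    by (auto simp only: gen_ideal_iff Int_iff)
  then have B: "f = a0 * B0 + a1 * B1 + a2 * B2 + a3 * B3" by (simp add: mult.commute)
  have "f = component (m + d) (n + e) f" using f component_of_bihom[of f "m + d" "n + e"] by simp
  also have "\<dots> = a0 * component d e B0 + a1 * component d e B1 + a2 * component d e B2 + a3 * component d e B3"
    unfolding B by (simp only: component_add component_mult[OF a(1)] component_mult[OF a(2)]
      component_mult[OF a(3)] component_mult[OF a(4)])
  finally show "f \<in> (\<lambda>(A0, A1, A2, A3). A0 * a0 + A1 * a1 + A2 * a2 + A3 * a3) ` bihom4 d e"
    by (intro image_eqI[of _ _ "(component d e B0, component d e B1, component d e B2, component d e B3)"])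
      (simp_all only: split_conv mult.commute bihom4_def component_bihom mem_Times_iff fst_conv snd_conv simp_thms)
next
  fix f assume "f \<in> (\<lambda>(A0, A1, A2, A3). A0 * a0 + A1 * a1 + A2 * a2 + A3 * a3) ` bihom4 d e"
  then obtain A where A: "A \<in> bihom4 d e"
    "f = (\<lambda>(A0, A1, A2, A3). A0 * a0 + A1 * a1 + A2 * a2 + A3 * a3) A" by (rule imageE)
  obtain A0 A1 A2 A3 where "A = (A0, A1, A2, A3)" by (rule prod_cases4)
  with A have A: "A0 \<in> bihom d e" "A1 \<in> bihom d e" "A2 \<in> bihom d e" "A3 \<in> bihom d e"
    "f = A0 * a0 + A1 * a1 + A2 * a2 + A3 * a3" by (simp_all only: bihom4_def mem_Times_iff split_conv fst_conv snd_conv)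
  have *: "B * a \<in> bihom (m + d) (n + e)" if "B \<in> bihom d e" "a \<in> bihom m n" for B a
    using bihom_mult[OF that(2,1)] by (simp add: mult.commute)
  have "f \<in> bihom (m + d) (n + e)" unfolding A(5) using A a by (intro bihom_add *)
  moreover have "f \<in> gen_ideal {a0, a1, a2, a3}" unfolding gen_ideal_iff using A(5) by blast
  ultimately show "f \<in> gen_ideal {a0, a1, a2, a3} \<inter> bihom (m + d) (n + e)" by blast
qed

lemma Syz_subspace: "module.subspace bscale4 (Syz a0 a1 a2 a3 d e)"
proof -
  interpret vector_space bscale4 by (rule vector_space_bscale4)
  have "bscale c A0 * a0 + bscale c A1 * a1 + bscale c A2 * a2 + bscale c A3 * a3 =
      bconst c * (A0 * a0 + A1 * a1 + A2 * a2 + A3 * a3)" for c A0 A1 A2 A3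
    by (simp add: bscale_def algebra_simps)
  moreover have "(A0 + B0) * a0 + (A1 + B1) * a1 + (A2 + B2) * a2 + (A3 + B3) * a3 =
      (A0 * a0 + A1 * a1 + A2 * a2 + A3 * a3) + (B0 * a0 + B1 * a1 + B2 * a2 + B3 * a3)"
    for A0 A1 A2 A3 B0 B1 B2 B3
    by (simp add: algebra_simps)
  ultimately show ?thesis
    by (intro subspaceI) (auto simp: Syz_def bscale4_def zero_prod_def intro: bihom_add bihom_bscale)
qed

lemma cokernel_dim_eq_dim_Syz:
  assumes a: "a0 \<in> bihom m n" "a1 \<in> bihom m n" "a2 \<in> bihom m n" "a3 \<in> bihom m n"
    and mn: "m \<ge> 1" "n \<ge> 1"
  shows "quot_dim bscale (bihom (2 * m - 1) (2 * n - 1))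
      (gen_ideal {a0, a1, a2, a3} \<inter> bihom (2 * m - 1) (2 * n - 1)) =
    enat (vector_space.dim bscale4 (Syz a0 a1 a2 a3 (m - 1) (n - 1)))"
proof -
  let ?R = "bihom (2 * m - 1) (2 * n - 1)" and ?S = "Syz a0 a1 a2 a3 (m - 1) (n - 1)"
  let ?J = "gen_ideal {a0, a1, a2, a3} \<inter> ?R" and ?R4 = "bihom4 (m - 1) (n - 1)"
  let ?\<Phi> = "\<lambda>(A0, A1, A2, A3). A0 * a0 + A1 * a1 + A2 * a2 + A3 * a3"
  interpret b: complex_vector_space bscale by (rule complex_vector_space.intro[OF vector_space_bscale])
  interpret b4: complex_vector_space bscale4 by (rule complex_vector_space.intro[OF vector_space_bscale4])
  have deg: "2 * m - 1 = m + (m - 1)" "2 * n - 1 = n + (n - 1)" using mn by auto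
  have J: "?J = ?\<Phi> ` ?R4" unfolding deg by (rule gen_ideal_bihom[OF a])
  have lin: "Vector_Spaces.linear bscale4 bscale ?\<Phi>"
    unfolding Vector_Spaces.linear_iff using vector_space_bscale vector_space_bscale4
    by (auto simp: bscale4_def bscale_def algebra_simps)
  interpret \<Phi>: Vector_Spaces.linear bscale4 bscale ?\<Phi> by (rule lin)
  have Jsub: "b.subspace ?J" unfolding J by (rule \<Phi>.subspace_image[OF bihom4_subspace])
  have SR: "?S \<subseteq> ?R4" by (auto simp: Syz_def bihom4_def)
  have "0 \<in> ?S" using b4.subspace_0[OF Syz_subspace] .
  have 1: "quot_dim bscale4 ?R4 {0} = quot_dim bscale4 ?R4 ?S + quot_dim bscale4 ?S {0}"
    using SR \<open>0 \<in> ?S\<close>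
    by (intro b4.quot_dim_add bihom4_subspace Syz_subspace b4.subspace_single_0) auto
  have 2: "quot_dim bscale4 ?R4 ?S = quot_dim bscale ?J {0}"
  proof (rule quot_dim_linear[OF lin Syz_subspace bihom4_subspace b.subspace_single_0])
    show "?\<Phi> A \<in> {0} \<longleftrightarrow> A \<in> ?S" if "A \<in> ?R4" for A
      using that by (auto simp: Syz_def bihom4_def)
    show "\<exists>A\<in>?R4. y - ?\<Phi> A \<in> {0}" if "y \<in> ?J" for y
      using that unfolding J by force
  qed (unfold J, blast)
  have 3: "quot_dim bscale ?R {0} = quot_dim bscale ?R ?J + quot_dim bscale ?J {0}"
    using b.subspace_0[OF Jsub]
    by (intro b.quot_dim_add bihom_subspace Jsub b.subspace_single_0) auto
  have 4: "quot_dim bscale4 ?R4 {0} = enat (4 * m * n)"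
    using mn by (simp add: quot_dim_bihom4)
  have "Suc (2 * m - 1) * Suc (2 * n - 1) = 4 * m * n" using mn by (simp add: algebra_simps)
  then have 5: "quot_dim bscale ?R {0} = enat (4 * m * n)" by (simp only: quot_dim_bihom)
  \<comment> \<open>The dimension of \<open>?J\<close> occurs in both counts; it can be cancelled in
    \<open>enat\<close> because everything is bounded by \<open>4 * m * n\<close>.\<close>
  obtain s j q where sjq: "quot_dim bscale4 ?S {0} = enat s" "quot_dim bscale ?J {0} = enat j"
    "quot_dim bscale ?R ?J = enat q"
    using 1 2 3 4 5 by (cases "quot_dim bscale4 ?S {0}"; cases "quot_dim bscale ?J {0}";
        cases "quot_dim bscale ?R ?J") auto
  then have "q = s" using 1 2 3 4 5 by simp
  then show ?thesis using sjq b4.dim_eq_quot_dim[OF Syz_subspace sjq(1)] by simp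
qed

theorem lemma4p5:
  fixes m n k :: nat and a0 a1 a2 a3 :: bipoly
  defines "I \<equiv> gen_ideal {a0, a1, a2, a3}"
  assumes "m \<ge> 1" and "n \<ge> 1"
    and "a0 \<in> bihom m n" and "a1 \<in> bihom m n" and "a2 \<in> bihom m n" and "a3 \<in> bihom m n"
    and B1: "\<And>c0 c1 c2 c3. bscale c0 a0 + bscale c1 a1 + bscale c2 a2 + bscale c3 a3 = 0
               \<Longrightarrow> c0 = 0 \<and> c1 = 0 \<and> c2 = 0 \<and> c3 = 0"
    and B2: "finite (base_points I)" "(\<Sum>p\<in>base_points I. hs_mult I p) = real k" "k \<le> m * n"
    and B3: "\<And>p. p \<in> base_points I \<Longrightarrow> lci_at I p"
    and B4: "quot_dim bscale (bihom (2 * m - 1) (2 * n - 1)) (I \<inter> bihom (2 * m - 1) (2 * n - 1))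
               = scheme_degree I"
  shows "vector_space.dim bscale4 (Syz a0 a1 a2 a3 (m - 1) (n - 1)) = k"
proof -
  let ?q = "\<lambda>p. quot_dim fscale (stalk UNIV p) (stalk I p)"
  let ?s = "vector_space.dim bscale4 (Syz a0 a1 a2 a3 (m - 1) (n - 1))"
  have I0: "0 \<in> I" unfolding I_def gen_ideal_iff by (intro exI[of _ 0]) simp
  \<comment> \<open>The multiplicity is identified conditionally on \<open>d\<close>, since
    finiteness of the colength emerges only from the global count below.\<close>
  have local: "module.subspace fscale (stalk I p) \<and> (\<forall>d. ?q p = enat d \<longrightarrow> hs_mult I p = real d)"
    if p: "p \<in> base_points I" for p
  proof -
    have "p \<in> P1 \<times> P1" using p by (auto simp: base_points_def)
    then obtain x y where xy: "proj_point p x y" by (rule point_rep)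
    interpret proj_point p x y by (rule xy)
    obtain f g where fg: "f \<in> stalk UNIV p" "g \<in> stalk UNIV p" "stalk I p = Idl\<^bsub>ring_of\<^esub> {f, g}"
      using B3[OF p] unfolding lci_at_def local_ring_eq by auto
    have "is_ideal (stalk I p)"
      using ring.genideal_ideal[OF ring_ring_of, of "{f, g}"] fg by (simp add: ideal_iff)
    moreover have "stalk I p \<subseteq> max_ideal"
    proof
      fix a assume "a \<in> stalk I p"
      then obtain f g d e where f: "a = Fract f g" "f \<in> I" "f \<in> bihom d e" "g \<in> bihom d e" "bieval g x y \<noteq> 0"
        by (rule stalkE)
      then have "bieval f x y = 0" using p vanishes_iff[OF f(3)] by (auto simp: base_points_def)
      then show "a \<in> max_ideal" using f by (auto intro: max_idealI)
    qed
    ultimately show ?thesis using hs_mult_eq_colength[OF B3[OF p]] is_ideal_subspace by blast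
  qed
  have "enat ?s = scheme_degree I"
    using cokernel_dim_eq_dim_Syz[OF assms(4-7,2,3)] B4 unfolding I_def by simp
  also have "\<dots> = (\<Sum>p\<in>base_points I. ?q p)"
    using local by (intro scheme_degree_eq_sum B2 I0) blast
  finally have sum: "enat ?s = (\<Sum>p\<in>base_points I. ?q p)" .
  \<comment> \<open>The sum equals the natural number \<open>?s\<close>, so each colength is finite
    and \<open>the_enat\<close> loses nothing.\<close>
  have fin: "?q p = enat (the_enat (?q p))" if p: "p \<in> base_points I" for p
  proof -
    have "?q p \<le> enat ?s" unfolding sum using B2(1) p by (intro member_le_sum) auto
    then show ?thesis by (auto dest!: enat_ile)
  qed
  have "enat ?s = (\<Sum>p\<in>base_points I. enat (the_enat (?q p)))"
    unfolding sum by (rule sum.cong[OF refl fin])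
  also have "\<dots> = enat (\<Sum>p\<in>base_points I. the_enat (?q p))"
    by (simp flip: of_nat_eq_enat)
  finally have "?s = (\<Sum>p\<in>base_points I. the_enat (?q p))" by simp
  also have "real \<dots> = (\<Sum>p\<in>base_points I. hs_mult I p)"
    unfolding of_nat_sum
  proof (rule sum.cong[OF refl])
    fix p assume "p \<in> base_points I"
    then show "real (the_enat (?q p)) = hs_mult I p" using local fin by metis
  qed
  also have "\<dots> = real k" by (rule B2(2))
  finally show ?thesis by simp
qed

end
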